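(* Let $\eta,\nu>0$ be constants and let $(k,\ell)\in(\mathcal{PC})$. Let $X(t)$, $t\ge 0$, be the stochastic process associated with the non-local in time telegraph equation with kernel $k$ and constants $\eta,\nu$, so that $\mathrm{Var}[X(t)]=2\nu\,(1\ast \ell\ast r_\eta)(t)$ for $t\ge 0$, where $r_\eta$ is the integral scalar resolvent associated to $\ell$. If the Laplace transform $\widehat{\ell}$ is a regularly varying function of index $\varrho_1<\frac12$, then \[ \mathrm{Var}[X(t)]\sim \frac{2\nu}{\Gamma(1-2\varrho_1)}\left(\widehat{\ell}\bigl(t^{-1}\bigr)\right)^2\quad\text{as } t\to 0^+ . \] Further, if the function $t\mapsto \widehat{\ell}(t^{-1})$ is a regularly varying function of index $\varrho_2>-1$, then \[ \mathrm{Var}[X(t)]\sim \frac{2\nu}{\eta\,\Gamma(1+\varrho_2)}\,\widehat{\ell}\Bigl(\frac1t\Bigr)\quad\text{as } t\to\infty . \]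
   Context: Notation: $\mathbb{R}_+=[0,\infty)$; $(f\ast g)(t)=\int_0^t f(t-s)g(s)\,ds$; $1$ denotes the constant function; $\widehat{f}(\lambda)=\int_0^\infty e^{-\lambda t}f(t)\,dt$ for $\lambda>0$ is the Laplace transform; $f(t)\sim g(t)$ as $t\to t_*$ means $\lim_{t\to t_*}f(t)/g(t)=1$. Kernels of type $(\mathcal{PC})$: $(k,\ell)\in(\mathcal{PC})$ means that $k\in L_{1,loc}(\mathbb{R}_+)$ is nonnegative and nonincreasing, $\ell\in L_{1,loc}(\mathbb{R}_+)$, and $(k\ast\ell)=1$ on $(0,\infty)$. Resolvent: the integral scalar resolvent $r_\eta$ associated to $\ell$ is the solution of the scalar Volterra equation $r_\eta(t)+\eta\,(r_\eta\ast\ell)(t)=\ell(t)$, $t>0$. The process $X(t)$: the telegraph equation is $\partial_t^2(k\ast k\ast u(\cdot,z))(t)+\eta\,\partial_t(k\ast u(\cdot,z))(t)-\nu\,\partial_z^2u(t,z)=0$ for $t>0$, $z\in\mathbb{R}$, with initial conditions $u(0,z)=\delta_0(z)$ and $\partial_tu(0,z)=0$ (the latter whenever it exists). It is known that, for $(k,\ell)\in(\mathcal{PC})$, its fundamental solution $U(t,\cdot)$ is a probability density on $\mathbb{R}$ for every $t>0$ and there is a process $X(t)$ whose distribution has density $U(t,\cdot)$; its variance is positive and increasing on $(0,\infty)$ and is given by $\mathrm{Var}[X(t)]=2\nu(1\ast\ell\ast r_\eta)(t)$, $t\ge0$. Regular variation: a function $L:(0,\infty)\to(0,\infty)$ is regularly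 varying of index $\varrho\in\mathbb{R}$ if for every fixed $x>0$, $\lim_{t\to\infty}L(tx)/L(t)=x^{\varrho}$.
   Formalization: The large-time asymptotics are stated under the extra assumption that ℓ is not integrable on [0,∞); for integrable ℓ with integral c, the variance tends to 2νc²/(1+ηc), not 2νc/η, so the printed claim fails. *)

theory Defs
  imports "HOL-Probability.Probability" "HOL-Library.Landau_Symbols"
begin

text \<open>Functions on the half-line are represented by total functions on the reals; their values
  at negative arguments never matter.  Locally integrable functions are determined only almost
  everywhere, so identities between them are required for almost every positive time.\<close>

definition L1_loc :: "(real \<Rightarrow> real) \<Rightarrow> bool" where
  "L1_loc f \<longleftrightarrow> (\<forall>T>0. set_integrable lborel {0..T} f)"

definition conv :: "(real \<Rightarrow> real) \<Rightarrow> (real \<Rightarrow> real) \<Rightarrow> real \<Rightarrow> real" where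
  "conv f g t = (LBINT s:{0..t}. f (t - s) * g s)"

definition laplace :: "(real \<Rightarrow> real) \<Rightarrow> real \<Rightarrow> real" where
  "laplace f x = (LBINT t:{0..}. exp (- x * t) * f t)"

definition kernel_PC :: "(real \<Rightarrow> real) \<Rightarrow> (real \<Rightarrow> real) \<Rightarrow> bool" where
  "kernel_PC k l \<longleftrightarrow>
     L1_loc k \<and> (\<forall>t>0. 0 \<le> k t) \<and> antimono_on {0<..} k \<and>
     L1_loc l \<and> (AE t in lborel. 0 < t \<longrightarrow> conv k l t = 1)"

definition is_resolvent :: "real \<Rightarrow> (real \<Rightarrow> real) \<Rightarrow> (real \<Rightarrow> real) \<Rightarrow> bool" where
  "is_resolvent \<eta> l r \<longleftrightarrow>
     L1_loc r \<and> (AE t in lborel. 0 < t \<longrightarrow> r t + \<eta> * conv r l t = l t)"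

text \<open>If \<open>(k, l)\<close> is of type PC, then \<open>l\<close> is nonnegative almost everywhere, so \<open>laplace l x \<rightarrow> \<infinity>\<close> as
  \<open>x \<rightarrow> 0\<close> unless \<open>l\<close> is integrable on \<open>[0, \<infinity>)\<close>.  In the latter case, with \<open>c\<close> the integral of \<open>l\<close>,
  the function \<open>laplace l (1 / t) \<rightarrow> c\<close> is regularly varying of index \<open>0\<close> at infinity, while
  \<open>2 \<nu> (1 * l * r) \<rightarrow> 2 \<nu> c\<^sup>2 / (1 + \<eta> c)\<close>, which differs from \<open>2 \<nu> c / \<eta>\<close>.  Hence a large time
  asymptotics in terms of \<open>laplace l (1 / t)\<close> has to exclude integrable \<open>l\<close>.\<close>

definition regularly_varying :: "(real \<Rightarrow> real) \<Rightarrow> real \<Rightarrow> bool" where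
  "regularly_varying L \<rho> \<longleftrightarrow>
     (\<forall>t>0. 0 < L t) \<and> (\<forall>x>0. ((\<lambda>t. L (t * x) / L t) \<longlongrightarrow> x powr \<rho>) at_top)"

definition test_function :: "(real \<Rightarrow> real) \<Rightarrow> bool" where
  "test_function \<phi> \<longleftrightarrow>
     (\<forall>n. (deriv ^^ n) \<phi> differentiable_on UNIV) \<and> bounded {z. \<phi> z \<noteq> 0}"

definition pairing :: "(real \<Rightarrow> real \<Rightarrow> real) \<Rightarrow> (real \<Rightarrow> real) \<Rightarrow> real \<Rightarrow> real" where
  "pairing U \<phi> t = (LBINT z. U t z * \<phi> z)"

text \<open>The telegraph equation in the sense of distributions in the space variable, for a solution
  starting from the Dirac measure at \<open>0\<close>.  The time derivatives of the convolutions act on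
  \<open>u - u(0)\<close>, which after testing with \<open>\<phi>\<close> becomes \<open>w t = pairing U \<phi> t - \<phi> 0\<close>.  For test
  functions supported away from \<open>0\<close> nothing is subtracted.  Without the subtraction, \<open>\<phi>\<close>
  approximating the constant \<open>1\<close> would force \<open>(k * k)' + \<eta> k = 0\<close>, so that no family of probability
  densities could be a solution.

  The second initial condition \<open>\<partial>\<^sub>t u(0) = 0\<close> is only meaningful for kernels of time order larger
  than one.  It is encoded by \<open>\<partial>\<^sub>t (k * k * (u - u(0))) \<rightarrow> 0\<close> as \<open>t \<rightarrow> 0\<close>, which makes sense for all
  kernels and becomes \<open>\<partial>\<^sub>t u(0) = 0\<close> in the formal limit where \<open>k\<close> is the Dirac measure.\<close>

definition telegraph_fundamental_solution ::
    "(real \<Rightarrow> real) \<Rightarrow> real \<Rightarrow> real \<Rightarrow> (real \<Rightarrow> real \<Rightarrow> real) \<Rightarrow> bool" where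
  "telegraph_fundamental_solution k \<eta> \<nu> U \<longleftrightarrow>
     (\<forall>\<phi>. test_function \<phi> \<longrightarrow>
        continuous_on {0<..} (pairing U \<phi>) \<and>
        (pairing U \<phi> \<longlongrightarrow> \<phi> 0) (at_right 0) \<and>
        (\<exists>D1 D2 E. let w = (\<lambda>t. pairing U \<phi> t - \<phi> 0) in
           (\<forall>t>0. (conv k (conv k w) has_real_derivative D1 t) (at t) \<and>
                  (D1 has_real_derivative D2 t) (at t) \<and>
                  (conv k w has_real_derivative E t) (at t) \<and>
                  D2 t + \<eta> * E t - \<nu> * pairing U (deriv (deriv \<phi>)) t = 0) \<and>
           (D1 \<longlongrightarrow> 0) (at_right 0)))"

definition telegraph_process ::
    "'a measure \<Rightarrow> (real \<Rightarrow> real) \<Rightarrow> real \<Rightarrow> real \<Rightarrow> (real \<Rightarrow> 'a \<Rightarrow> real) \<Rightarrow> bool" where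
  "telegraph_process M k \<eta> \<nu> X \<longleftrightarrow>
     prob_space M \<and>
     (\<forall>t\<ge>0. X t \<in> borel_measurable M) \<and>
     (AE \<omega> in M. X 0 \<omega> = 0) \<and>
     (\<exists>U. telegraph_fundamental_solution k \<eta> \<nu> U \<and>
          (\<forall>t>0. (\<forall>z. 0 \<le> U t z) \<and>
                 distributed M lborel (X t) (\<lambda>z. ennreal (U t z))))"

end

theory Submission
  imports Defs
begin

text \<open>Up to the factor \<open>2 \<nu>\<close> the variance is \<open>W = 1 * l * r\<close>, whose Laplace transform at \<open>x\<close> is
  \<open>\<lambda>\<^sup>2 / (x (1 + \<eta> \<lambda>))\<close> with \<open>\<lambda> = laplace l x\<close>.  Since \<open>\<lambda> \<rightarrow> 0\<close> as \<open>x \<rightarrow> \<infinity>\<close>, and \<open>\<lambda> \<rightarrow> \<infinity>\<close> as \<open>x \<rightarrow> 0\<close>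
  if \<open>l\<close> is not integrable, this transform behaves like \<open>\<lambda>\<^sup>2 / x\<close> and \<open>\<lambda> / (\<eta> x)\<close>, respectively,
  and Karamata's Tauberian theorem for monotone functions yields the claim.

  Monotonicity of \<open>W\<close> rests on \<open>l \<ge> 0\<close> and \<open>r \<ge> 0\<close>.  If \<open>k\<close> is a nonincreasing step function on a
  uniform grid, then \<open>k * m = 1\<close> is solved by a measure \<open>m\<close> on the grid, and a discrete renewal
  equation shows \<open>m \<ge> 0\<close>.  Approximating a general \<open>k\<close> by step functions exhibits the primitive of
  \<open>l\<close> as a limit of nondecreasing functions.  As \<open>(k + \<eta>) * r = 1\<close>, the same applies to \<open>r\<close>.\<close>

subsection \<open>Convolutions and Laplace transforms\<close>

text \<open>The obstacle is the sign of \<open>l\<close>: \<open>kernel_PC\<close> prescribes a sign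
  for \<open>k\<close> only. As \<open>k\<close> may be singular at 0 and \<open>k * l = 1\<close>
  holds almost everywhere only, this equation gives no direct pointwise access to \<open>l\<close>.
  Discretisation works because errors in L1 suffice: the total weight stays bounded as the mesh
  \<open>h\<close> shrinks, while the step kernel is off by at most the integral of \<open>k\<close>
  over \<open>(0, h]\<close>. Before positivity is known, Laplace transforms are out of reach, since
  \<open>L1_loc\<close> does not restrict growth. Afterwards they are multiplied in
  \<open>ennreal\<close>, where Tonelli holds unconditionally, and convergence at \<open>x\<close>
  is read off from \<open>0 < laplace l x\<close>, because a divergent Bochner integral has value 0.
  The index conditions come from the transform of \<open>W\<close>. If \<lambda> has index \<rho>1
  at infinity, then \<lambda>^2 / x has index 2 \<rho>1 - 1 = -\<alpha>; near 0, \<lambda> / x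
  scales with exponent -(1 + \<rho>2) = -\<alpha>. Both bounds say \<alpha> > 0, and Gamma \<alpha>
  is the Tauberian constant. Since \<open>W\<close> itself is monotone, it enters the Tauberian
  theorem as a density, without passing to a primitive.\<close>

definition nn_conv :: "(real \<Rightarrow> ennreal) \<Rightarrow> (real \<Rightarrow> ennreal) \<Rightarrow> real \<Rightarrow> ennreal" where
  "nn_conv f g t = (\<integral>\<^sup>+s. f (t - s) * g s \<partial>lborel)"

lemma measurable_nn_conv [measurable]:
  assumes [measurable]: "f \<in> borel_measurable borel" "g \<in> borel_measurable borel"
  shows "nn_conv f g \<in> borel_measurable borel"
  unfolding nn_conv_def by measurable

text \<open>Tonelli and the shift \<open>t = u + s\<close>, with a free weight \<open>w\<close>.
  Taking an indicator of \<open>{..T}\<close> controls local integrability of convolutions; taking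
  an exponential gives the product rule for transforms.\<close>

lemma nn_integral_mult_nn_conv:
  assumes [measurable]: "f \<in> borel_measurable borel" "g \<in> borel_measurable borel"
    "w \<in> borel_measurable borel"
  shows "(\<integral>\<^sup>+t. w t * nn_conv f g t \<partial>lborel) = (\<integral>\<^sup>+s. \<integral>\<^sup>+u. w (u + s) * f u * g s \<partial>lborel \<partial>lborel)"
proof -
  have "(\<integral>\<^sup>+t. w t * nn_conv f g t \<partial>lborel) = (\<integral>\<^sup>+t. \<integral>\<^sup>+s. w t * (f (t - s) * g s) \<partial>lborel \<partial>lborel)"
    by (simp add: nn_conv_def nn_integral_cmult)
  also have "\<dots> = (\<integral>\<^sup>+s. \<integral>\<^sup>+t. w t * (f (t - s) * g s) \<partial>lborel \<partial>lborel)"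
    by (rule lborel_pair.Fubini') measurable
  also have "\<dots> = (\<integral>\<^sup>+s. \<integral>\<^sup>+u. w (u + s) * f u * g s \<partial>lborel \<partial>lborel)"
  proof (rule nn_integral_cong)
    fix s :: real
    show "(\<integral>\<^sup>+t. w t * (f (t - s) * g s) \<partial>lborel) = (\<integral>\<^sup>+u. w (u + s) * f u * g s \<partial>lborel)"
      by (subst nn_integral_real_affine[where c=1 and t=s]) (auto simp: ac_simps)
  qed
  finally show ?thesis .
qed

text \<open>For nonnegative \<open>u\<close> and \<open>s\<close>, the condition
  \<open>u + s \<le> T\<close> forces \<open>u \<le> T\<close> and \<open>s \<le> T\<close>, so the
  triangle of integration lies in a square.\<close>

lemma nn_integral_nn_conv_le:
  assumes [measurable]: "f \<in> borel_measurable borel" "g \<in> borel_measurable borel"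
  assumes f0: "\<And>t. t < 0 \<Longrightarrow> f t = 0" and g0: "\<And>t. t < 0 \<Longrightarrow> g t = 0"
  shows "(\<integral>\<^sup>+t. indicator {..T} t * nn_conv f g t \<partial>lborel)
    \<le> (\<integral>\<^sup>+t. indicator {..T} t * f t \<partial>lborel) * (\<integral>\<^sup>+t. indicator {..T} t * g t \<partial>lborel)"
proof -
  have "(\<integral>\<^sup>+t. indicator {..T} t * nn_conv f g t \<partial>lborel) =
      (\<integral>\<^sup>+s. \<integral>\<^sup>+u. indicator {..T} (u + s) * f u * g s \<partial>lborel \<partial>lborel)"
    by (rule nn_integral_mult_nn_conv) measurable
  also have "\<dots> \<le> (\<integral>\<^sup>+s. \<integral>\<^sup>+u. (indicator {..T} u * f u) * (indicator {..T} s * g s) \<partial>lborel \<partial>lborel)"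
    by (intro nn_integral_mono) (auto simp: indicator_def f0 g0 not_le intro: ccontr)
  also have "\<dots> = (\<integral>\<^sup>+t. indicator {..T} t * f t \<partial>lborel) * (\<integral>\<^sup>+t. indicator {..T} t * g t \<partial>lborel)"
    by (simp add: nn_integral_multc nn_integral_cmult)
  finally show ?thesis .
qed

definition nn_laplace :: "(real \<Rightarrow> ennreal) \<Rightarrow> real \<Rightarrow> ennreal" where
  "nn_laplace f x = (\<integral>\<^sup>+t. ennreal (exp (- x * t)) * f t \<partial>lborel)"

lemma nn_laplace_nn_conv:
  assumes [measurable]: "f \<in> borel_measurable borel" "g \<in> borel_measurable borel"
  shows "nn_laplace (nn_conv f g) x = nn_laplace f x * nn_laplace g x"
proof -
  have "(\<integral>\<^sup>+t. ennreal (exp (- x * t)) * nn_conv f g t \<partial>lborel) =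
      (\<integral>\<^sup>+s. \<integral>\<^sup>+u. ennreal (exp (- x * (u + s))) * f u * g s \<partial>lborel \<partial>lborel)"
    by (rule nn_integral_mult_nn_conv) measurable
  also have "\<dots> = (\<integral>\<^sup>+s. \<integral>\<^sup>+u. (ennreal (exp (- x * u)) * f u) * (ennreal (exp (- x * s)) * g s) \<partial>lborel \<partial>lborel)"
    by (intro nn_integral_cong) (simp add: ring_distribs exp_add exp_diff exp_minus ennreal_mult' ac_simps divide_inverse)
  also have "\<dots> = (\<integral>\<^sup>+t. ennreal (exp (- x * t)) * f t \<partial>lborel) * (\<integral>\<^sup>+t. ennreal (exp (- x * t)) * g t \<partial>lborel)"
    by (simp add: nn_integral_multc nn_integral_cmult)
  finally show ?thesis unfolding nn_laplace_def .
qed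

definition lconv :: "(real \<Rightarrow> real) \<Rightarrow> (real \<Rightarrow> real) \<Rightarrow> real \<Rightarrow> real" where
  "lconv f g t = (\<integral>s. f (t - s) * g s \<partial>lborel)"

lemma measurable_lconv [measurable]:
  assumes [measurable]: "f \<in> borel_measurable borel" "g \<in> borel_measurable borel"
  shows "lconv f g \<in> borel_measurable borel"
  unfolding lconv_def by measurable

lemma lconv_commute: "lconv f g t = lconv g f t"
  unfolding lconv_def
  by (subst lborel_integral_real_affine[where c="-1" and t=t]) (auto simp: ac_simps)

text \<open>Functions on the half-line are extended by zero, so that convolutions become integrals over
  the whole line.\<close>

definition causal :: "(real \<Rightarrow> real) \<Rightarrow> real \<Rightarrow> real" where
  "causal f t = indicator {0<..} t * f t"

lemma causal_pos [simp]: "t > 0 \<Longrightarrow> causal f t = f t"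
  by (simp add: causal_def)

lemma causal_nonpos [simp]: "t \<le> 0 \<Longrightarrow> causal f t = 0"
  by (simp add: causal_def)

text \<open>The integrands agree except possibly at the endpoints \<open>s = 0\<close> and
  \<open>s = t\<close>, where \<open>causal\<close> drops the value.\<close>

lemma conv_eq_lconv: "conv f g t = lconv (causal f) (causal g) t"
  unfolding conv_def lconv_def set_lebesgue_integral_def
  by (rule integral_discrete_difference[of "{0, t}"]) (auto simp: indicator_def causal_def)

text \<open>The premise is integrability of the Fubini integrand at this particular
  \<open>t\<close>. For locally integrable functions on the half-line it holds at almost every
  \<open>t\<close>, which is how it is supplied later.\<close>

lemma lconv_assoc:
  assumes [measurable]: "f \<in> borel_measurable borel" "g \<in> borel_measurable borel"
    "h \<in> borel_measurable borel"
  assumes fin: "nn_conv (\<lambda>t. ennreal \<bar>f t\<bar>) (nn_conv (\<lambda>t. ennreal \<bar>g t\<bar>) (\<lambda>t. ennreal \<bar>h t\<bar>)) t < \<infinity>"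
  shows "lconv f (lconv g h) t = lconv (lconv f g) h t"
proof -
  let ?F = "\<lambda>(s, u). f (t - s) * (g (s - u) * h u)"
  have int: "integrable (lborel \<Otimes>\<^sub>M lborel) ?F"
  proof (rule integrableI_bounded)
    have "(\<integral>\<^sup>+z. ennreal (norm (?F z)) \<partial>(lborel \<Otimes>\<^sub>M lborel)) =
        (\<integral>\<^sup>+s. \<integral>\<^sup>+u. ennreal (norm (?F (s, u))) \<partial>lborel \<partial>lborel)"
      by (rule lborel.nn_integral_fst[symmetric]) measurable
    also have "\<dots> = nn_conv (\<lambda>t. ennreal \<bar>f t\<bar>) (nn_conv (\<lambda>t. ennreal \<bar>g t\<bar>) (\<lambda>t. ennreal \<bar>h t\<bar>)) t"
      by (simp add: nn_conv_def abs_mult ennreal_mult nn_integral_cmult)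
    finally show "(\<integral>\<^sup>+z. ennreal (norm (?F z)) \<partial>(lborel \<Otimes>\<^sub>M lborel)) < \<infinity>"
      using fin by simp
  qed measurable
  have "lconv f (lconv g h) t = (\<integral>s. \<integral>u. f (t - s) * (g (s - u) * h u) \<partial>lborel \<partial>lborel)"
    by (simp add: lconv_def)
  also have "\<dots> = (\<integral>u. \<integral>s. f (t - s) * (g (s - u) * h u) \<partial>lborel \<partial>lborel)"
    using lborel_pair.Fubini_integral[OF int] by simp
  also have "\<dots> = (\<integral>u. (\<integral>s. f (t - u - s) * g s \<partial>lborel) * h u \<partial>lborel)"
  proof (rule Bochner_Integration.integral_cong[OF refl])
    fix u
    have "(\<integral>s. f (t - s) * (g (s - u) * h u) \<partial>lborel) = (\<integral>s. (f (t - s) * g (s - u)) * h u \<partial>lborel)"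
      by (simp add: ac_simps)
    also have "\<dots> = (\<integral>s. f (t - s) * g (s - u) \<partial>lborel) * h u"
      by (rule integral_mult_left_zero)
    also have "(\<integral>s. f (t - s) * g (s - u) \<partial>lborel) = (\<integral>s. f (t - u - s) * g s \<partial>lborel)"
      by (subst lborel_integral_real_affine[where c=1 and t=u]) (auto simp: diff_diff_eq)
    finally show "(\<integral>s. f (t - s) * (g (s - u) * h u) \<partial>lborel) = (\<integral>s. f (t - u - s) * g s \<partial>lborel) * h u" .
  qed
  finally show ?thesis by (simp add: lconv_def)
qed

subsection \<open>Positivity of the convolution inverse of a nonincreasing kernel\<close>

lemma L1_loc_causal:
  assumes "L1_loc f"
  shows "causal f \<in> borel_measurable borel"
    and "integrable lborel (\<lambda>t. indicator {..T} t * causal f t)"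
proof -
  have int: "integrable lborel (\<lambda>t. indicator {0..T} t * f t)" if "T > 0" for T
    using assms that by (simp add: L1_loc_def set_integrable_def)
  then have [measurable]: "(\<lambda>t. indicator {0..real (Suc n)} t * f t) \<in> borel_measurable borel" for n
    using borel_measurable_integrable[OF int[of "real (Suc n)"]] by simp
  show "causal f \<in> borel_measurable borel"
  proof (rule borel_measurable_LIMSEQ_real)
    show "(\<lambda>n. indicator {0<..} t * (indicator {0..real (Suc n)} t * f t)) \<longlonglongrightarrow> causal f t" for t
    proof (rule tendsto_eventually)
      obtain m where m: "t \<le> real m"
        using real_arch_simple by blast
      show "\<forall>\<^sub>F n in sequentially. indicator {0<..} t * (indicator {0..real (Suc n)} t * f t) = causal f t"
        using eventually_ge_at_top[of m] by eventually_elim (use m in \<open>auto simp: causal_def indicator_def\<close>)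
    qed
  qed measurable
  show "integrable lborel (\<lambda>t. indicator {..T} t * causal f t)"
  proof -
    have "integrable lborel (\<lambda>t. indicator {0<..T} t * (indicator {0..max T 1} t * f t))"
      using integrable_mult_indicator[OF _ int[of "max T 1"], of "{0<..T}"] by simp
    also have "(\<lambda>t. indicator {0<..T} t * (indicator {0..max T 1} t * f t)) = (\<lambda>t. indicator {..T} t * causal f t)"
      by (auto simp: causal_def indicator_def fun_eq_iff)
    finally show ?thesis .
  qed
qed

section \<open>The discrete renewal equation\<close>

fun renewal_seq :: "(nat \<Rightarrow> real) \<Rightarrow> nat \<Rightarrow> real" where
  "renewal_seq a n = (1 - (\<Sum>j<n. a (Suc n - j) * renewal_seq a j)) / a 1"

declare renewal_seq.simps [simp del]

text \<open>\<open>renewal_seq\<close> is forward substitution in this triangular system: the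
  \<open>n\<close>-th equation determines the entry \<open>n - 1\<close>, whose coefficient is
  \<open>a 1\<close>.\<close>

lemma renewal_seq_eq:
  assumes "a 1 \<noteq> 0" and "n > 0"
  shows "(\<Sum>j<n. a (n - j) * renewal_seq a j) = 1"
proof -
  obtain m where n: "n = Suc m"
    using assms(2) gr0_conv_Suc by blast
  have "(\<Sum>j<n. a (n - j) * renewal_seq a j) =
      (\<Sum>j<m. a (n - j) * renewal_seq a j) + a 1 * renewal_seq a m"
    by (simp add: n)
  also have "a 1 * renewal_seq a m = 1 - (\<Sum>j<m. a (n - j) * renewal_seq a j)"
    using assms(1) by (subst renewal_seq.simps) (simp add: n)
  finally show ?thesis by simp
qed

text \<open>Nonnegativity comes from subtracting two consecutive renewal equations, which leaves
  the nonnegative weights \<open>a (n - j) - a (Suc n - j)\<close>.\<close>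

lemma renewal_seq_nonneg:
  assumes "a 1 > 0" and "\<And>n. n > 0 \<Longrightarrow> a (Suc n) \<le> a n"
  shows "renewal_seq a n \<ge> 0"
proof (induction n rule: less_induct)
  case (less n)
  have "(\<Sum>j<n. a (Suc n - j) * renewal_seq a j) \<le> 1"
  proof (cases "n = 0")
    case False
    have "(\<Sum>j<n. a (Suc n - j) * renewal_seq a j) \<le> (\<Sum>j<n. a (n - j) * renewal_seq a j)"
      using less assms(2) by (intro sum_mono mult_right_mono) (auto simp: Suc_diff_le)
    also have "\<dots> = 1"
      using False assms(1) by (intro renewal_seq_eq) auto
    finally show ?thesis .
  qed simp
  then show ?case
    using assms(1) by (subst renewal_seq.simps) simp
qed

text \<open>Add the renewal equations for \<open>n = 1..2*N\<close>; the total is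
  \<open>2 * N\<close>. Every pair \<open>j < N\<close>, \<open>1 \<le> i \<le> N\<close> occurs in
  one of them, namely \<open>n = i + j\<close>, and all remaining terms are nonnegative.\<close>

lemma sum_renewal_seq_le:
  assumes "a 1 > 0" and "\<And>n. n > 0 \<Longrightarrow> a (Suc n) \<le> a n" and "\<And>n. n > 0 \<Longrightarrow> 0 \<le> a n"
  shows "(\<Sum>j<N. renewal_seq a j) * (\<Sum>i=1..N. a i) \<le> 2 * real N"
proof -
  let ?w = "renewal_seq a"
  have w: "?w j \<ge> 0" for j
    using renewal_seq_nonneg[of a j] assms by auto
  have "(\<Sum>j<N. ?w j) * (\<Sum>i=1..N. a i) = (\<Sum>j<N. \<Sum>i=1..N. a i * ?w j)"
    by (simp add: sum_product ac_simps)
  also have "\<dots> = (\<Sum>j<N. \<Sum>n\<in>{j+1..j+N}. a (n - j) * ?w j)"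
  proof (rule sum.cong[OF refl])
    fix j
    show "(\<Sum>i=1..N. a i * ?w j) = (\<Sum>n\<in>{j+1..j+N}. a (n - j) * ?w j)"
      by (rule sum.reindex_bij_witness[where i="\<lambda>n. n - j" and j="\<lambda>i. i + j"]) auto
  qed
  also have "\<dots> \<le> (\<Sum>j<2*N. \<Sum>n\<in>{n\<in>{1..2*N}. j < n}. a (n - j) * ?w j)"
  proof -
    have "(\<Sum>j<N. \<Sum>n\<in>{j+1..j+N}. a (n - j) * ?w j) \<le> (\<Sum>j<N. \<Sum>n\<in>{n\<in>{1..2*N}. j < n}. a (n - j) * ?w j)"
      using w assms(3) by (intro sum_mono sum_mono2) auto
    also have "\<dots> \<le> (\<Sum>j<2*N. \<Sum>n\<in>{n\<in>{1..2*N}. j < n}. a (n - j) * ?w j)"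
      using w assms(3) by (intro sum_mono2) (auto intro!: sum_nonneg)
    finally show ?thesis .
  qed
  also have "\<dots> = (\<Sum>n\<in>{1..2*N}. \<Sum>j\<in>{j\<in>{..<2*N}. j < n}. a (n - j) * ?w j)"
    by (rule sum.swap_restrict) auto
  also have "\<dots> = (\<Sum>n\<in>{1..2*N}. \<Sum>j<n. a (n - j) * ?w j)"
    by (intro sum.cong refl) auto
  also have "\<dots> = (\<Sum>n\<in>{1..2*N}. 1)"
    using assms(1) by (intro sum.cong refl renewal_seq_eq) auto
  also have "\<dots> = 2 * real N" by simp
  finally show ?thesis .
qed

lemma AE_lborel_shift:
  assumes [measurable]: "Measurable.pred borel P" and "AE t in lborel. P (t::real)"
  shows "AE t in lborel. P (t - c)"
proof -
  have "AE t in lborel. P (- c + 1 * t)"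
    by (rule AE_borel_affine) (use assms in auto)
  then show ?thesis by (simp add: algebra_simps)
qed

section \<open>Step approximation of a nonincreasing kernel\<close>

locale monotone_kernel =
  fixes k :: "real \<Rightarrow> real"
  assumes measurable_k [measurable]: "k \<in> borel_measurable borel"
    and k_nonpos: "t \<le> 0 \<Longrightarrow> k t = 0"
    and k_nonneg: "0 \<le> k t"
    and k_antimono: "0 < s \<Longrightarrow> s \<le> t \<Longrightarrow> k t \<le> k s"
    and k_integrable: "integrable lborel (\<lambda>t. indicator {..T} t * k t)"
begin

definition K :: "real \<Rightarrow> real" where
  "K T = (\<integral>t. indicator {..T} t * k t \<partial>lborel)"

text \<open>Sampling at the right end of each grid cell keeps the step function below
  \<open>k\<close> and bounded by \<open>k h\<close>, even if \<open>k\<close> is singular at 0. On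
  the \<open>n\<close>-th cell its value is \<open>k (n * h)\<close>, the coefficient of the renewal
  equation.\<close>

definition step :: "real \<Rightarrow> real \<Rightarrow> real" where
  "step h t = (if t > 0 then k (h * real_of_int \<lceil>t / h\<rceil>) else 0)"

lemma measurable_step [measurable]: "step h \<in> borel_measurable borel"
  unfolding step_def by measurable

lemma step_bounds:
  assumes "h > 0"
  shows "0 \<le> step h t" "step h t \<le> k t" "step h t \<le> k h" "t > 0 \<Longrightarrow> k (t + h) \<le> step h t"
proof -
  show "0 \<le> step h t" by (simp add: step_def k_nonneg)
  have *: "t \<le> h * real_of_int \<lceil>t / h\<rceil>" "h * real_of_int \<lceil>t / h\<rceil> \<le> t + h"
  proof -
    have "t = h * (t / h)" using assms by simp
    also have "\<dots> \<le> h * real_of_int \<lceil>t / h\<rceil>"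
      using assms by (intro mult_left_mono le_of_int_ceiling) auto
    finally show "t \<le> h * real_of_int \<lceil>t / h\<rceil>" .
    have "h * real_of_int \<lceil>t / h\<rceil> \<le> h * (t / h + 1)"
      using assms by (intro mult_left_mono of_int_ceiling_le_add_one) auto
    also have "\<dots> = t + h" using assms by (simp add: field_simps)
    finally show "h * real_of_int \<lceil>t / h\<rceil> \<le> t + h" .
  qed
  show "step h t \<le> k t"
    using * k_antimono[of t] by (auto simp: step_def k_nonneg)
  show "k (t + h) \<le> step h t" if "t > 0"
    using * that k_antimono[of "h * real_of_int \<lceil>t / h\<rceil>" "t + h"] by (auto simp: step_def)
  show "step h t \<le> k h"
  proof (cases "t > 0")
    case True
    then have "1 \<le> \<lceil>t / h\<rceil>" using assms by (simp add: less_ceiling_iff)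
    then have "h * 1 \<le> h * real_of_int \<lceil>t / h\<rceil>"
      using assms by (intro mult_left_mono) auto
    then show ?thesis
      using True assms k_antimono[of h "h * real_of_int \<lceil>t / h\<rceil>"] by (simp add: step_def)
  qed (simp add: step_def k_nonneg)
qed

lemma K_nonneg: "0 \<le> K T"
  unfolding K_def by (intro integral_nonneg_AE) (auto simp: k_nonneg)

lemma integrable_k_shift:
  assumes "h > 0"
  shows "integrable lborel (\<lambda>t. indicator {0<..T} t * k (t + h))"
    and "T > 0 \<Longrightarrow> (\<integral>t. indicator {0<..T} t * k (t + h) \<partial>lborel) = K (T + h) - K h"
proof -
  have i: "integrable lborel (\<lambda>t. indicator {..T + h} t * k t - indicator {..h} t * k t)"
    by (intro Bochner_Integration.integrable_diff k_integrable)
  have eq: "(\<lambda>t. indicator {..T + h} (h + 1 * t) * k (h + 1 * t) - indicator {..h} (h + 1 * t) * k (h + 1 * t)) =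
      (\<lambda>t. indicator {0<..T} t * k (t + h))" if "T > 0"
    using that by (auto simp: fun_eq_iff indicator_def ac_simps)
  show "(\<integral>t. indicator {0<..T} t * k (t + h) \<partial>lborel) = K (T + h) - K h" if "T > 0"
    using eq[OF that] lborel_integral_real_affine[of 1 "\<lambda>t. indicator {..T + h} t * k t - indicator {..h} t * k t" h]
    by (simp add: K_def k_integrable)
  show "integrable lborel (\<lambda>t. indicator {0<..T} t * k (t + h))"
  proof (cases "T > 0")
    case True
    then show ?thesis
      using lborel_integrable_real_affine[OF i, of 1 h] eq by simp
  qed simp
qed

lemma K_mono: "S \<le> T \<Longrightarrow> K S \<le> K T"
  unfolding K_def
  by (intro integral_mono k_integrable) (auto simp: indicator_def k_nonneg)

text \<open>Squeezing the step function between \<open>k (t + h)\<close> and \<open>k t\<close>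
  bounds the error by \<open>k t - k (t + h)\<close>. The integral of this difference telescopes to
  \<open>K h\<close> minus the mass of \<open>k\<close> between \<open>T\<close> and
  \<open>T + h\<close>.\<close>

lemma step_approx:
  assumes "h > 0" "T > 0"
  shows "(\<integral>\<^sup>+t. indicator {..T} t * ennreal \<bar>step h t - k t\<bar> \<partial>lborel) \<le> ennreal (K h)"
proof -
  have "(\<integral>\<^sup>+t. indicator {..T} t * ennreal \<bar>step h t - k t\<bar> \<partial>lborel) \<le>
     (\<integral>\<^sup>+t. ennreal (indicator {..T} t * k t - indicator {0<..T} t * k (t + h)) \<partial>lborel)"
  proof (rule nn_integral_mono)
    fix t
    show "indicator {..T} t * ennreal \<bar>step h t - k t\<bar> \<le>
        ennreal (indicator {..T} t * k t - indicator {0<..T} t * k (t + h))"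
      using step_bounds[OF assms(1), of t]
      by (cases "t > 0") (auto simp: indicator_def k_nonpos step_def)
  qed
  also have "\<dots> = ennreal (\<integral>t. indicator {..T} t * k t - indicator {0<..T} t * k (t + h) \<partial>lborel)"
  proof (rule nn_integral_eq_integral)
    show "AE t in lborel. 0 \<le> indicator {..T} t * k t - indicator {0<..T} t * k (t + h)"
      using assms k_antimono by (auto simp: indicator_def k_nonneg)
  qed (use assms integrable_k_shift k_integrable in auto)
  also have "(\<integral>t. indicator {..T} t * k t - indicator {0<..T} t * k (t + h) \<partial>lborel) = K T - (K (T + h) - K h)"
    using integrable_k_shift[OF assms(1), of T] assms k_integrable[of T] by (simp add: K_def)
  also have "\<dots> \<le> K h"
    using K_mono[of T "T + h"] assms by simp
  finally show ?thesis by (simp add: ennreal_leI)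
qed

lemma K_tendsto_0: "(\<lambda>n. K (T / real (Suc n))) \<longlonglongrightarrow> 0"
proof -
  have "(\<lambda>n. K (T / real (Suc n))) \<longlonglongrightarrow> integral\<^sup>L lborel (\<lambda>t::real. 0)"
    unfolding K_def
  proof (rule integral_dominated_convergence)
    show "integrable lborel (\<lambda>t. indicator {..\<bar>T\<bar>} t * k t)" by (rule k_integrable)
    show "AE t in lborel. (\<lambda>n. indicator {..T / real (Suc n)} t * k t) \<longlonglongrightarrow> 0"
    proof (intro always_eventually allI)
      fix t
      have "(\<lambda>n. T / real (Suc n)) \<longlonglongrightarrow> 0"
        by (rule LIMSEQ_Suc[OF lim_const_over_n])
      then have "\<forall>\<^sub>F n in sequentially. T / real (Suc n) < t" if "t > 0"
        using order_tendstoD(2) that by blast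
      then show "(\<lambda>n. indicator {..T / real (Suc n)} t * k t) \<longlonglongrightarrow> 0"
        by (cases "t > 0") (auto simp: k_nonpos indicator_def intro!: tendsto_eventually elim!: eventually_mono)
    qed
    have "T / real (Suc n) \<le> \<bar>T\<bar>" for n
    proof -
      have "T / real (Suc n) \<le> \<bar>T\<bar> / real (Suc n)" by (intro divide_right_mono) auto
      also have "\<dots> \<le> \<bar>T\<bar> / 1" by (intro divide_left_mono) auto
      finally show ?thesis by simp
    qed
    then show "AE t in lborel. norm (indicator {..T / real (Suc n)} t * k t) \<le> indicator {..\<bar>T\<bar>} t * k t" for n
      by (auto simp: indicator_def k_nonneg intro: order_trans)
  qed measurable
  then show ?thesis by simp
qed

text \<open>An upper Riemann sum with left endpoints. The cell next to 0 is left out, because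
  \<open>k\<close> may be unbounded there; this accounts for \<open>- K h\<close>.\<close>

lemma K_diff_le_sum:
  assumes "h > 0"
  shows "K (real N * h + h) - K h \<le> h * (\<Sum>i=1..N. k (real i * h))"
proof (induction N)
  case (Suc N)
  have "K (real (Suc N) * h + h) - K (real N * h + h) =
      (\<integral>t. indicator {..real (Suc N) * h + h} t * k t - indicator {..real N * h + h} t * k t \<partial>lborel)"
    by (simp add: K_def k_integrable)
  also have "\<dots> \<le> (\<integral>t. indicator {real (Suc N) * h..real (Suc N) * h + h} t * k (real (Suc N) * h) \<partial>lborel)"
  proof (rule integral_mono)
    fix t
    show "indicator {..real (Suc N) * h + h} t * k t - indicator {..real N * h + h} t * k t \<le>
        indicator {real (Suc N) * h..real (Suc N) * h + h} t * k (real (Suc N) * h)"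
      using assms k_nonneg[of "real (Suc N) * h"] k_antimono[of "real (Suc N) * h" t]
      by (auto simp: indicator_def algebra_simps add_pos_nonneg)
  qed (auto intro!: k_integrable integrable_real_indicator simp: emeasure_lborel_Icc_eq)
  also have "\<dots> = h * k (real (Suc N) * h)"
    using assms by simp
  finally show ?case using Suc by (simp add: algebra_simps)
qed simp

context
  fixes h :: real
  assumes h: "h > 0" and kh: "k h > 0"
begin

definition weight :: "nat \<Rightarrow> real" where
  "weight = renewal_seq (\<lambda>n. k (real n * h))"

lemma weight_nonneg: "0 \<le> weight j"
  unfolding weight_def
  by (rule renewal_seq_nonneg) (use h kh in \<open>auto intro!: k_antimono\<close>)

text \<open>Trading samples for an integral of \<open>k\<close> bounds the total weight in terms of
  \<open>T = N * h\<close> alone, as soon as \<open>K h\<close> is small compared with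
  \<open>K T\<close>.\<close>

lemma sum_weight_le:
  "(\<Sum>j<N. weight j) * (K (real N * h + h) - K h) \<le> 2 * (real N * h)"
proof -
  have "(\<Sum>j<N. weight j) * (K (real N * h + h) - K h) \<le>
      (\<Sum>j<N. weight j) * (h * (\<Sum>i=1..N. k (real i * h)))"
    by (intro mult_left_mono K_diff_le_sum h sum_nonneg weight_nonneg)
  also have "\<dots> = h * ((\<Sum>j<N. weight j) * (\<Sum>i=1..N. k (real i * h)))"
    by (simp add: ac_simps)
  also have "\<dots> \<le> h * (2 * real N)"
    unfolding weight_def
    by (intro mult_left_mono sum_renewal_seq_le) (use h kh in \<open>auto intro!: k_antimono k_nonneg\<close>)
  finally show ?thesis by (simp add: ac_simps)
qed

text \<open>This is \<open>step h * m = 1\<close> for the measure \<open>m\<close> with mass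
  \<open>weight j\<close> at \<open>j * h\<close>. If \<open>t\<close> lies in the
  \<open>n\<close>-th cell, shifting by \<open>j * h\<close> moves it to cell \<open>n - j\<close>,
  and shifts with \<open>j \<ge> n\<close> contribute nothing. What remains is the
  \<open>n\<close>-th renewal equation; \<open>t \<le> N * h\<close> ensures
  \<open>n \<le> N\<close>, so the truncation loses no term.\<close>

lemma sum_weight_step:
  assumes t: "0 < t" "t \<le> real N * h"
  shows "(\<Sum>j<N. weight j * step h (t - real j * h)) = 1"
proof -
  define n where "n = nat \<lceil>t / h\<rceil>"
  have pos: "t / h > 0" using t h by simp
  then have n0: "n > 0" and n: "real_of_int \<lceil>t / h\<rceil> = real n"
    by (auto simp: n_def)
  have "\<lceil>t / h\<rceil> \<le> int N"
  proof (rule ceiling_le)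
    show "t / h \<le> of_int (int N)"
      using t h by (simp add: pos_divide_le_eq)
  qed
  then have nN: "n \<le> N" unfolding n_def by linarith
  have lower: "real n - 1 < t / h" and upper: "t / h \<le> real n"
    using ceiling_correct[of "t / h"] by (auto simp: n)
  have "(\<Sum>j<N. weight j * step h (t - real j * h)) = (\<Sum>j<n. k (real (n - j) * h) * weight j)"
  proof (rule sum.mono_neutral_cong_right)
    show "\<forall>j\<in>{..<N} - {..<n}. weight j * step h (t - real j * h) = 0"
    proof
      fix j assume "j \<in> {..<N} - {..<n}"
      then have "t / h \<le> real j" using upper by auto
      then have "t \<le> real j * h" using h by (simp add: field_simps)
      then show "weight j * step h (t - real j * h) = 0" by (simp add: step_def)
    qed
    fix j assume "j \<in> {..<n}"
    then have j: "j < n" by simp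
    then have "real j \<le> real n - 1" by linarith
    then have "real j < t / h" using lower by linarith
    then have p: "t - real j * h > 0" using h by (simp add: field_simps)
    have "(t - real j * h) / h = t / h - of_int (int j)"
      using h by (simp add: field_simps)
    then have "\<lceil>(t - real j * h) / h\<rceil> = \<lceil>t / h\<rceil> - int j"
      by (metis ceiling_diff_of_int)
    then have "real_of_int \<lceil>(t - real j * h) / h\<rceil> = real (n - j)"
      using n j by (simp add: of_nat_diff)
    then show "weight j * step h (t - real j * h) = k (real (n - j) * h) * weight j"
      using p by (simp add: step_def mult.commute)
  qed (use nN in auto)
  also have "\<dots> = 1"
    unfolding weight_def using n0 kh renewal_seq_eq[of "\<lambda>n. k (real n * h)" n] by simp
  finally show ?thesis .
qed

text \<open>The distribution function of the truncated measure \<open>m\<close>, that is,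
  \<open>1 * m\<close>. It is the monotone approximant to the primitive of \<open>l\<close>.\<close>

definition renewal_count :: "nat \<Rightarrow> real \<Rightarrow> real" where
  "renewal_count N t = (\<Sum>j<N. weight j * indicator {0<..} (t - real j * h))"

lemma measurable_renewal_count [measurable]: "renewal_count N \<in> borel_measurable borel"
  unfolding renewal_count_def by measurable

lemma renewal_count_mono: "s \<le> t \<Longrightarrow> renewal_count N s \<le> renewal_count N t"
  unfolding renewal_count_def
  by (intro sum_mono mult_left_mono weight_nonneg) (auto simp: indicator_def)

text \<open>Convolving the identity \<open>sum_weight_step\<close> with \<open>l\<close> gives the primitive of \<open>l\<close>, and
  replacing \<open>step h\<close> by \<open>k\<close> in the result turns it into \<open>renewal_count\<close>, as \<open>k * l = 1\<close>.\<close>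

lemma renewal_count_approx:
  fixes l :: "real \<Rightarrow> real"
  assumes [measurable]: "l \<in> borel_measurable borel"
    and l0: "\<And>t. t \<le> 0 \<Longrightarrow> l t = 0"
    and l_int: "\<And>T. integrable lborel (\<lambda>t. indicator {..T} t * l t)"
    and kl: "AE t in lborel. 0 < t \<longrightarrow> lconv k l t = 1"
    and T: "T = real N * h" "T > 0"
  shows "(\<integral>\<^sup>+t. indicator {..T} t * ennreal \<bar>(\<integral>s. indicator {..t} s * l s \<partial>lborel) - renewal_count N t\<bar> \<partial>lborel)
    \<le> ennreal ((\<Sum>j<N. weight j) * K h) * (\<integral>\<^sup>+t. indicator {..T} t * ennreal \<bar>l t\<bar> \<partial>lborel)"
proof -
  define D where "D t = ennreal \<bar>step h t - k t\<bar>" for t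
  define L where "L t = ennreal \<bar>l t\<bar>" for t
  have [measurable]: "D \<in> borel_measurable borel" "L \<in> borel_measurable borel"
    unfolding D_def L_def by measurable
  have int_step: "integrable lborel (\<lambda>s. step h (t - s) * l s)" for t
  proof (rule Bochner_Integration.integrable_bound)
    show "integrable lborel (\<lambda>s. k h * (indicator {..t} s * l s))"
      using l_int by simp
    show "AE s in lborel. norm (step h (t - s) * l s) \<le> norm (k h * (indicator {..t} s * l s))"
    proof (intro always_eventually allI)
      fix s
      show "norm (step h (t - s) * l s) \<le> norm (k h * (indicator {..t} s * l s))"
        using step_bounds[OF h, of "t - s"] kh
        by (cases "s < t") (auto simp: abs_mult step_def intro!: mult_right_mono)
    qed
  qed measurable
  have primitive: "(\<integral>s. indicator {..t} s * l s \<partial>lborel) = (\<Sum>j<N. weight j * lconv (step h) l (t - real j * h))"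
    if "t \<le> T" for t
  proof -
    \<comment> \<open>The point \<open>s = t\<close> has to be removed: there the sum vanishes,
      since \<open>step h\<close> is 0 at nonpositive arguments, whereas the left integrand is
      \<open>l t\<close>.\<close>
    have "(\<integral>s. indicator {..t} s * l s \<partial>lborel) =
        (\<integral>s. (\<Sum>j<N. weight j * (step h (t - real j * h - s) * l s)) \<partial>lborel)"
    proof (rule integral_discrete_difference[of "{t}"])
      fix s assume "s \<in> space lborel" "s \<notin> {t}"
      then have st: "s \<noteq> t" by simp
      have "(\<Sum>j<N. weight j * (step h (t - real j * h - s) * l s)) =
          (\<Sum>j<N. weight j * step h ((t - s) - real j * h)) * l s"
        by (simp add: sum_distrib_right diff_diff_eq add.commute mult.assoc)
      also have "\<dots> = indicator {..t} s * l s"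
      proof (cases "0 < s \<and> s < t")
        case True
        then show ?thesis using sum_weight_step[of "t - s" N] that T by simp
      next
        case False
        then consider "s \<le> 0" | "s > t" using st by linarith
        then show ?thesis
        proof cases
          case 2
          have "step h ((t - s) - real j * h) = 0" for j
          proof -
            have "real j * h \<ge> 0" using h by simp
            then show ?thesis using 2 by (simp add: step_def)
          qed
          then show ?thesis using 2 by simp
        qed (simp add: l0)
      qed
      finally show "indicator {..t} s * l s = (\<Sum>j<N. weight j * (step h (t - real j * h - s) * l s))" by simp
    qed auto
    also have "\<dots> = (\<Sum>j<N. weight j * lconv (step h) l (t - real j * h))"
      using int_step by (simp add: lconv_def)
    finally show ?thesis .
  qed
  have "AE t in lborel. \<forall>j<N. 0 < t - real j * h \<longrightarrow> lconv k l (t - real j * h) = 1"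
  proof -
    have "AE t in lborel. 0 < t - real j * h \<longrightarrow> lconv k l (t - real j * h) = 1" for j
      by (rule AE_lborel_shift[OF _ kl]) measurable
    then have "AE t in lborel. \<forall>j. 0 < t - real j * h \<longrightarrow> lconv k l (t - real j * h) = 1"
      by (simp only: AE_all_countable) blast
    then show ?thesis by eventually_elim blast
  qed
  then have "AE t in lborel. indicator {..T} t * ennreal \<bar>(\<integral>s. indicator {..t} s * l s \<partial>lborel) - renewal_count N t\<bar>
      \<le> (\<Sum>j<N. ennreal (weight j) * (indicator {..T} t * nn_conv D L (t - real j * h)))"
  proof eventually_elim
    fix t assume ae: "\<forall>j<N. 0 < t - real j * h \<longrightarrow> lconv k l (t - real j * h) = 1"
    have bound: "ennreal \<bar>lconv (step h) l u - indicator {0<..} u\<bar> \<le> nn_conv D L u"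
      if "0 < u \<longrightarrow> lconv k l u = 1" for u
    proof (cases "0 < u")
      case True
      then have 1: "lconv k l u = 1" using that by simp
      \<comment> \<open>A nonintegrable function has Bochner integral 0, so the value 1 already
        implies integrability.\<close>
      have ik: "integrable lborel (\<lambda>s. k (u - s) * l s)"
        using 1 not_integrable_integral_eq unfolding lconv_def by fastforce
      have "lconv (step h) l u - indicator {0<..} u = (\<integral>s. (step h (u - s) - k (u - s)) * l s \<partial>lborel)"
        using True 1 ik int_step[of u] by (simp add: lconv_def left_diff_distrib)
      also have "ennreal \<bar>\<dots>\<bar> \<le> (\<integral>\<^sup>+s. ennreal \<bar>(step h (u - s) - k (u - s)) * l s\<bar> \<partial>lborel)"
        using integral_norm_bound_ennreal[of lborel "\<lambda>s. (step h (u - s) - k (u - s)) * l s"] ik int_step[of u]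
        by (simp add: left_diff_distrib)
      also have "\<dots> = nn_conv D L u"
        by (simp add: nn_conv_def D_def L_def abs_mult ennreal_mult)
      finally show ?thesis .
    next
      case False
      have "(\<lambda>s. step h (u - s) * l s) = (\<lambda>s. 0)"
        using False by (auto simp: fun_eq_iff step_def l0)
      then have "lconv (step h) l u = 0"
        by (simp add: lconv_def)
      then show ?thesis using False by simp
    qed
    show "indicator {..T} t * ennreal \<bar>(\<integral>s. indicator {..t} s * l s \<partial>lborel) - renewal_count N t\<bar>
      \<le> (\<Sum>j<N. ennreal (weight j) * (indicator {..T} t * nn_conv D L (t - real j * h)))"
    proof (cases "t \<le> T")
      case True
      have "ennreal \<bar>(\<integral>s. indicator {..t} s * l s \<partial>lborel) - renewal_count N t\<bar> =
         ennreal \<bar>\<Sum>j<N. weight j * (lconv (step h) l (t - real j * h) - indicator {0<..} (t - real j * h))\<bar>"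
        using primitive[OF True] by (simp add: renewal_count_def sum_subtractf right_diff_distrib)
      also have "\<dots> \<le> ennreal (\<Sum>j<N. weight j * \<bar>lconv (step h) l (t - real j * h) - indicator {0<..} (t - real j * h)\<bar>)"
        by (intro ennreal_leI order_trans[OF sum_abs]) (simp add: abs_mult weight_nonneg)
      also have "\<dots> = (\<Sum>j<N. ennreal (weight j) * ennreal \<bar>lconv (step h) l (t - real j * h) - indicator {0<..} (t - real j * h)\<bar>)"
        by (simp add: weight_nonneg ennreal_mult flip: sum_ennreal)
      also have "\<dots> \<le> (\<Sum>j<N. ennreal (weight j) * nn_conv D L (t - real j * h))"
        by (intro sum_mono mult_left_mono bound) (use ae in auto)
      finally show ?thesis using True by simp
    qed simp
  qed
  then have "(\<integral>\<^sup>+t. indicator {..T} t * ennreal \<bar>(\<integral>s. indicator {..t} s * l s \<partial>lborel) - renewal_count N t\<bar> \<partial>lborel)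
    \<le> (\<integral>\<^sup>+t. (\<Sum>j<N. ennreal (weight j) * (indicator {..T} t * nn_conv D L (t - real j * h))) \<partial>lborel)"
    by (rule nn_integral_mono_AE)
  also have "\<dots> = (\<Sum>j<N. ennreal (weight j) * (\<integral>\<^sup>+t. indicator {..T} t * nn_conv D L (t - real j * h) \<partial>lborel))"
    by (simp add: nn_integral_sum nn_integral_cmult)
  also have "\<dots> \<le> (\<Sum>j<N. ennreal (weight j) * (ennreal (K h) * (\<integral>\<^sup>+t. indicator {..T} t * L t \<partial>lborel)))"
  proof (intro sum_mono mult_left_mono)
    fix j
    have "(\<integral>\<^sup>+t. indicator {..T} t * nn_conv D L (t - real j * h) \<partial>lborel) =
        (\<integral>\<^sup>+t. indicator {..T} (real j * h + t) * nn_conv D L t \<partial>lborel)"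
      by (subst nn_integral_real_affine[where c=1 and t="real j * h"]) auto
    also have "\<dots> \<le> (\<integral>\<^sup>+t. indicator {..T} t * nn_conv D L t \<partial>lborel)"
    proof (intro nn_integral_mono mult_right_mono)
      fix t
      have "real j * h \<ge> 0" using h by simp
      then show "indicator {..T} (real j * h + t) \<le> (indicator {..T} t :: ennreal)"
        by (auto simp: indicator_def)
    qed simp
    also have "\<dots> \<le> (\<integral>\<^sup>+t. indicator {..T} t * D t \<partial>lborel) * (\<integral>\<^sup>+t. indicator {..T} t * L t \<partial>lborel)"
      by (rule nn_integral_nn_conv_le) (auto simp: D_def L_def l0 k_nonpos step_def)
    also have "\<dots> \<le> ennreal (K h) * (\<integral>\<^sup>+t. indicator {..T} t * L t \<partial>lborel)"
      unfolding D_def by (intro mult_right_mono step_approx h T) simp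
    finally show "(\<integral>\<^sup>+t. indicator {..T} t * nn_conv D L (t - real j * h) \<partial>lborel) \<le>
        ennreal (K h) * (\<integral>\<^sup>+t. indicator {..T} t * L t \<partial>lborel)" .
  qed simp
  also have "\<dots> = ennreal ((\<Sum>j<N. weight j) * K h) * (\<integral>\<^sup>+t. indicator {..T} t * L t \<partial>lborel)"
    by (simp add: sum_distrib_right[symmetric] mult.assoc[symmetric] sum_nonneg weight_nonneg ennreal_mult' K_nonneg flip: sum_ennreal)
       (simp add: ennreal_mult sum_nonneg weight_nonneg K_nonneg)?
  finally show ?thesis by (simp add: L_def)
qed

end

lemma exists_pos:
  assumes "AE t in lborel. 0 < t \<longrightarrow> lconv k l t = 1"
  obtains \<delta> where "\<delta> > 0" "k \<delta> > 0"
proof -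
  have "\<exists>\<delta>>0. k \<delta> > 0"
  proof (rule ccontr)
    assume *: "\<not> ?thesis"
    have k0: "k t = 0" for t
    proof (cases "t > 0")
      case True
      then have "\<not> k t > 0" using * by blast
      then show ?thesis using k_nonneg[of t] by linarith
    qed (simp add: k_nonpos)
    have "AE t in lborel. t \<notin> {0<..<1::real}"
      using assms by (auto simp: lconv_def k0)
    then have "emeasure lborel {0<..<1::real} = 0"
      using AE_iff_null_sets[of "{0<..<1::real}" lborel] by (auto simp: null_sets_def)
    then show False by simp
  qed
  then show ?thesis using that by blast
qed

lemma K_pos:
  assumes "\<delta> > 0" "k \<delta> > 0" "\<delta> \<le> T"
  shows "K T > 0"
proof -
  have "0 < \<delta> * k \<delta>" using assms by simp
  also have "\<dots> = (\<integral>t. indicator {0<..\<delta>} t * k \<delta> \<partial>lborel)"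
    using assms by simp
  also have "\<dots> \<le> K T"
    unfolding K_def
  proof (rule integral_mono)
    show "indicator {0<..\<delta>} t * k \<delta> \<le> indicator {..T} t * k t" for t
      using assms k_antimono[of t \<delta>] by (auto simp: indicator_def k_nonneg)
  qed (use assms in \<open>auto intro!: k_integrable integrable_real_indicator\<close>)
  finally show ?thesis .
qed

section \<open>Nonnegativity in the limit of vanishing mesh\<close>

context
  fixes l :: "real \<Rightarrow> real"
  assumes measurable_l [measurable]: "l \<in> borel_measurable borel"
    and l0: "\<And>t. t \<le> 0 \<Longrightarrow> l t = 0"
    and l_int: "\<And>T. integrable lborel (\<lambda>t. indicator {..T} t * l t)"
    and kl: "AE t in lborel. 0 < t \<longrightarrow> lconv k l t = 1"
begin

text \<open>The error is at most total weight times \<open>K h\<close> times the L1 norm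
  \<open>A\<close> of \<open>l\<close> on \<open>{..T}\<close>. Meshes of the form
  \<open>T / Suc n\<close> make \<open>T\<close> a grid point. The requirement
  \<open>h n < \<delta>\<close> gives \<open>k (h n) > 0\<close>, so that the weights exist;
  \<open>K (h n) < K T / 2\<close> caps the total weight at \<open>4 * T / K T\<close>; and then
  \<open>K (h n)\<close> tending to 0 makes the product small.\<close>

lemma mono_approx:
  assumes "T > 0" "\<epsilon> > 0"
  obtains R :: "real \<Rightarrow> real" where "R \<in> borel_measurable borel" "mono R"
    "(\<integral>\<^sup>+t. indicator {..T} t * ennreal \<bar>(\<integral>s. indicator {..t} s * l s \<partial>lborel) - R t\<bar> \<partial>lborel) \<le> ennreal \<epsilon>"
proof -
  obtain \<delta>0 where \<delta>0: "\<delta>0 > 0" "k \<delta>0 > 0"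
    using exists_pos kl by blast
  define \<delta> where "\<delta> = min \<delta>0 T"
  have \<delta>: "\<delta> > 0" "k \<delta> > 0" "\<delta> \<le> T"
    using \<delta>0 assms k_antimono[of \<delta> \<delta>0] by (auto simp: \<delta>_def)
  define A where "A = (\<integral>t. \<bar>indicator {..T} t * l t\<bar> \<partial>lborel)"
  have A: "(\<integral>\<^sup>+t. indicator {..T} t * ennreal \<bar>l t\<bar> \<partial>lborel) = ennreal A"
  proof -
    have "(\<integral>\<^sup>+t. indicator {..T} t * ennreal \<bar>l t\<bar> \<partial>lborel) = (\<integral>\<^sup>+t. ennreal \<bar>indicator {..T} t * l t\<bar> \<partial>lborel)"
      by (intro nn_integral_cong) (auto simp: indicator_def)
    also have "\<dots> = ennreal A"
      unfolding A_def by (rule nn_integral_eq_integral) (use l_int in auto)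
    finally show ?thesis .
  qed
  have A0: "A \<ge> 0" unfolding A_def by simp
  have KT: "K T > 0" using K_pos \<delta> by blast
  define h where "h n = T / real (Suc n)" for n
  have h0: "h n > 0" for n using assms by (simp add: h_def)
  have "(\<lambda>n. h n) \<longlonglongrightarrow> 0"
    unfolding h_def by (rule LIMSEQ_Suc[OF lim_const_over_n])
  then have ev1: "\<forall>\<^sub>F n in sequentially. h n < \<delta>"
    using \<delta>(1) order_tendstoD(2) by blast
  have Kh: "(\<lambda>n. K (h n)) \<longlonglongrightarrow> 0"
    unfolding h_def by (rule K_tendsto_0)
  have ev2: "\<forall>\<^sub>F n in sequentially. K (h n) < K T / 2"
    using order_tendstoD(2)[OF Kh half_gt_zero[OF KT]] .
  have "(\<lambda>n. 4 * T / K T * K (h n) * A) \<longlonglongrightarrow> 4 * T / K T * 0 * A"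
    by (intro tendsto_intros Kh)
  then have ev3: "\<forall>\<^sub>F n in sequentially. 4 * T / K T * K (h n) * A < \<epsilon>"
    using assms order_tendstoD(2) by force
  obtain n where n: "h n < \<delta>" "K (h n) < K T / 2" "4 * T / K T * K (h n) * A < \<epsilon>"
    using eventually_conj[OF ev1 eventually_conj[OF ev2 ev3]] eventually_happens'[OF sequentially_bot] by blast
  have kh: "k (h n) > 0"
    using k_antimono[of "h n" \<delta>] n(1) \<delta> h0[of n] by simp
  have T: "T = real (Suc n) * h n" by (simp add: h_def)
  define W where "W = (\<Sum>j<Suc n. weight (h n) j)"
  have W0: "W \<ge> 0" unfolding W_def by (intro sum_nonneg weight_nonneg h0 kh)
  have "W * (K T / 2) \<le> W * (K (T + h n) - K (h n))"
    using n(2) K_mono[of T "T + h n"] h0[of n] by (intro mult_left_mono W0) simp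
  also have "\<dots> \<le> 2 * T"
    using sum_weight_le[OF h0 kh, of "Suc n"] T by (simp add: W_def)
  finally have W: "W \<le> 4 * T / K T"
    using KT by (simp add: field_simps)
  have "(\<integral>\<^sup>+t. indicator {..T} t * ennreal \<bar>(\<integral>s. indicator {..t} s * l s \<partial>lborel) - renewal_count (h n) (Suc n) t\<bar> \<partial>lborel)
    \<le> ennreal (W * K (h n)) * ennreal A"
    using renewal_count_approx[OF h0 kh measurable_l l0 l_int kl T assms(1)] by (simp add: W_def A)
  also have "\<dots> = ennreal (W * K (h n) * A)"
    using A0 W0 K_nonneg by (simp add: ennreal_mult)
  also have "\<dots> \<le> ennreal \<epsilon>"
  proof (rule ennreal_leI)
    have "W * K (h n) * A \<le> 4 * T / K T * K (h n) * A"
      by (intro mult_right_mono W A0 K_nonneg)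
    then show "W * K (h n) * A \<le> \<epsilon>" using n(3) by linarith
  qed
  finally show ?thesis
    using that[of "renewal_count (h n) (Suc n)"] renewal_count_mono[OF h0 kh] measurable_renewal_count[OF h0 kh]
    by (simp add: monoI)
qed

lemma l_integrable_on: "l integrable_on {a..b}"
proof -
  have "set_integrable lborel {..b} l" using l_int[of b] by (simp add: set_integrable_def)
  then have "set_integrable lborel {a..b} l"
    by (rule set_integrable_subset) auto
  then show ?thesis using set_borel_integral_eq_integral(1) by blast
qed

lemma primitive_eq: "(\<integral>s. indicator {..t} s * l s \<partial>lborel) = integral {0..t} l"
proof -
  have "set_integrable lborel {..t} l" using l_int[of t] by (simp add: set_integrable_def)
  then have "set_integrable lborel {0..t} l"
    by (rule set_integrable_subset) auto
  then have "integral {0..t} l = (LINT s:{0..t}|lborel. l s)"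
    by (simp add: set_borel_integral_eq_integral(2))
  also have "\<dots> = (\<integral>s. indicator {..t} s * l s \<partial>lborel)"
    unfolding set_lebesgue_integral_def
    by (intro Bochner_Integration.integral_cong refl) (auto simp: indicator_def l0)
  finally show ?thesis by simp
qed

text \<open>Closeness in L1 to a nondecreasing \<open>R\<close> says nothing at single points, so
  continuity of the primitive \<open>M\<close> is used to spread a drop from \<open>a\<close> to
  \<open>b\<close> over windows of length \<open>d\<close> to the right of both points. For
  \<open>t\<close> in the first window and its translate \<open>t'\<close> in the second,
  \<open>R t \<le> R t'\<close> while \<open>M\<close> falls by at least \<open>2 * e\<close>, so
  the two errors add up to at least \<open>2 * e\<close>.\<close>

lemma primitive_mono:
  assumes ab: "0 \<le> a" "a < b"
  shows "integral {0..a} l \<le> integral {0..b} l"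
proof (rule ccontr)
  define M where "M t = integral {0..t} l" for t
  assume "\<not> integral {0..a} l \<le> integral {0..b} l"
  define e where "e = (M a - M b) / 4"
  have e: "e > 0" using \<open>\<not> _\<close> by (simp add: e_def M_def)
  define T where "T = b + 1"
  have "continuous_on {0..T} M"
    unfolding M_def by (intro indefinite_integral_continuous_1 l_integrable_on)
  then have cont: "\<exists>d>0. \<forall>t\<in>{0..T}. dist t x < d \<longrightarrow> dist (M t) (M x) < e" if "x \<in> {0..T}" for x
    using that e by (auto simp: continuous_on_iff)
  obtain d1 where d1: "d1 > 0" "\<And>t. t \<in> {0..T} \<Longrightarrow> dist t a < d1 \<Longrightarrow> dist (M t) (M a) < e"
    using cont[of a] ab by (auto simp: T_def)
  obtain d2 where d2: "d2 > 0" "\<And>t. t \<in> {0..T} \<Longrightarrow> dist t b < d2 \<Longrightarrow> dist (M t) (M b) < e"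
    using cont[of b] ab by (auto simp: T_def)
  define d where "d = min 1 (min d1 d2) / 2"
  have d: "d > 0" "d < 1" "d < d1" "d < d2" using d1(1) d2(1) by (auto simp: d_def min_def)
  \<comment> \<open>Each window is charged the L1 error once, at most \<open>e * d\<close> in total,
    against the lower bound \<open>2 * e * d\<close>. Choosing \<open>T = b + 1\<close> and
    \<open>d < 1\<close> keeps both windows inside \<open>{..T}\<close>.\<close>
  obtain R :: "real \<Rightarrow> real" where [measurable]: "R \<in> borel_measurable borel" and R: "mono R"
    and RM: "(\<integral>\<^sup>+t. indicator {..T} t * ennreal \<bar>M t - R t\<bar> \<partial>lborel) \<le> ennreal (e * d / 2)"
    using mono_approx[of T "e * d / 2"] ab e d by (auto simp: T_def primitive_eq M_def)
  have M_meas [measurable]: "M \<in> borel_measurable borel"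
  proof -
    have "M = (\<lambda>t. \<integral>s. indicator {..t} s * l s \<partial>lborel)"
      by (simp add: M_def primitive_eq fun_eq_iff)
    also have "(\<lambda>t. \<integral>s. indicator {..t} s * l s \<partial>lborel) = (\<lambda>t. \<integral>s. indicator {0..} (t - s) * l s \<partial>lborel)"
      by (intro ext Bochner_Integration.integral_cong) (auto simp: indicator_def)
    also have "\<dots> \<in> borel_measurable borel" by measurable
    finally show ?thesis .
  qed
  define G where "G t = indicator {..T} t * ennreal \<bar>M t - R t\<bar>" for t
  have [measurable]: "G \<in> borel_measurable borel" unfolding G_def by measurable
  have "ennreal (2 * e * d) = (\<integral>\<^sup>+t. ennreal (2 * e) * indicator {a..a+d} t \<partial>lborel)"
    using e d by (simp add: nn_integral_cmult ennreal_mult)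
  also have "\<dots> \<le> (\<integral>\<^sup>+t. G t + G ((b - a) + 1 * t) \<partial>lborel)"
  proof (rule nn_integral_mono)
    fix t
    show "ennreal (2 * e) * indicator {a..a+d} t \<le> G t + G ((b - a) + 1 * t)"
    proof (cases "t \<in> {a..a+d}")
      case True
      define t' where "t' = (b - a) + t"
      have 1: "dist (M t) (M a) < e" using True ab d by (intro d1) (auto simp: T_def dist_real_def)
      have 2: "dist (M t') (M b) < e" using True ab d by (intro d2) (auto simp: T_def dist_real_def t'_def)
      have 3: "R t \<le> R t'" using R ab by (auto simp: mono_def t'_def)
      have "M t > M a - e" "M t' < M b + e"
        using 1 2 by (auto simp: dist_real_def abs_less_iff)
      moreover have "M a - M b = 4 * e" by (simp add: e_def)
      ultimately have "2 * e \<le> \<bar>M t - R t\<bar> + \<bar>M t' - R t'\<bar>"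
        using 3 by linarith
      then have "ennreal (2 * e) \<le> ennreal (\<bar>M t - R t\<bar> + \<bar>M t' - R t'\<bar>)" by (rule ennreal_leI)
      then show ?thesis using True ab d by (simp add: G_def t'_def T_def)
    qed simp
  qed
  also have "\<dots> = (\<integral>\<^sup>+t. G t \<partial>lborel) + (\<integral>\<^sup>+t. G ((b - a) + 1 * t) \<partial>lborel)"
    by (rule nn_integral_add) measurable
  also have "(\<integral>\<^sup>+t. G ((b - a) + 1 * t) \<partial>lborel) = (\<integral>\<^sup>+t. G t \<partial>lborel)"
    using nn_integral_real_affine[of G 1 "b - a"] by simp
  also have "(\<integral>\<^sup>+t. G t \<partial>lborel) + (\<integral>\<^sup>+t. G t \<partial>lborel) \<le> ennreal (e * d / 2) + ennreal (e * d / 2)"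
    using RM unfolding G_def by (intro add_mono)
  also have "\<dots> = ennreal (e * d)"
    using e d by (simp flip: ennreal_plus)
  finally have "2 * e * d \<le> e * d"
    using e d by (simp add: ennreal_le_iff)
  then show False using e d by (simp add: mult_le_cancel_right)
qed

text \<open>Lebesgue differentiation: off a negligible set \<open>l x\<close> is the limit of
  difference quotients of its primitive, and these are nonnegative because the primitive is
  nondecreasing. For \<open>x \<le> 0\<close> the value is 0 by assumption.\<close>

lemma AE_nonneg: "AE t in lborel. 0 \<le> l t"
proof -
  obtain N where N: "negligible N" "\<And>x e. \<lbrakk>x \<notin> N; 0 < e\<rbrakk> \<Longrightarrow>
     \<exists>d>0. \<forall>h. 0 < h \<and> h < d \<longrightarrow> norm (integral (cbox x (x + h *\<^sub>R One)) l /\<^sub>R h ^ DIM(real) - l x) < e"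
    using integrable_ccontinuous_explicit[of l] l_integrable_on by auto
  have "0 \<le> l x" if xN: "x \<notin> N" for x
  proof (rule ccontr)
    assume "\<not> 0 \<le> l x"
    then have neg: "- l x > 0" and x: "x > 0" using l0[of x] by (auto simp: not_le intro: ccontr)
    obtain d where d: "d > 0" "\<And>h. 0 < h \<Longrightarrow> h < d \<Longrightarrow> norm (integral {x..x+h} l / h - l x) < - l x"
      using N(2)[OF xN neg] by (auto simp: field_simps)
    define h where "h = d / 2"
    have h: "h > 0" "h < d" using d(1) by (auto simp: h_def)
    have "integral {0..x} l + integral {x..x+h} l = integral {0..x+h} l"
      using x h by (intro Henstock_Kurzweil_Integration.integral_combine l_integrable_on) auto
    moreover have "integral {0..x} l \<le> integral {0..x+h} l"
      using x h by (intro primitive_mono) auto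
    ultimately have "integral {x..x+h} l / h \<ge> 0" using h by simp
    then show False using d(2)[OF h] by (simp add: abs_if split: if_splits)
  qed
  then have "{x. \<not> 0 \<le> l x} \<subseteq> N" by blast
  then have "negligible {x. \<not> 0 \<le> l x}"
    using N(1) negligible_subset by blast
  then have "AE x in lebesgue. 0 \<le> l x"
    by (simp add: negligible_iff_null_sets AE_iff_null_sets[symmetric] AE_iff_null)
  then show ?thesis
    by (simp add: AE_completion_iff)
qed

end

end

subsection \<open>A Tauberian theorem for monotone functions\<close>

text \<open>Normalised so that its Laplace transform is \<open>p powr (- \<alpha>)\<close>. It is
  the limit profile of the rescaled function, and its value at 1 is the Tauberian constant.\<close>

definition gamma_weight :: "real \<Rightarrow> real \<Rightarrow> real" where
  "gamma_weight \<alpha> s = indicator {0<..} s * s powr (\<alpha> - 1) / Gamma \<alpha>"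

lemma gamma_weight_nonneg: "\<alpha> > 0 \<Longrightarrow> 0 \<le> gamma_weight \<alpha> s"
  by (simp add: gamma_weight_def less_imp_le[OF Gamma_real_pos])

lemma measurable_gamma_weight [measurable]: "gamma_weight \<alpha> \<in> borel_measurable borel"
  unfolding gamma_weight_def by measurable

lemma has_bochner_integral_gamma_weight:
  assumes "\<alpha> > 0" "p > 0"
  shows "has_bochner_integral lborel (\<lambda>s. exp (- p * s) * gamma_weight \<alpha> s) (p powr (- \<alpha>))"
proof -
  let ?f = "\<lambda>s. exp (- s) * gamma_weight \<alpha> s"
  have G: "Gamma \<alpha> > 0" using assms by (rule_tac Gamma_real_pos)
  have "has_bochner_integral lborel (\<lambda>t. indicator {0..} t * t powr (\<alpha> - 1) / exp t) (Gamma \<alpha>)"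
    using G by (intro has_bochner_integral_nn_integral)
      (auto simp: Gamma_conv_nn_integral_real[OF assms(1)] less_top[symmetric] intro!: ennreal_enn2real[symmetric])
  then have "has_bochner_integral lborel (\<lambda>t. indicator {0..} t * t powr (\<alpha> - 1) / exp t / Gamma \<alpha>) (Gamma \<alpha> / Gamma \<alpha>)"
    by (intro has_bochner_integral_divide_zero)
  also have "Gamma \<alpha> / Gamma \<alpha> = 1" using G by simp
  also have "(\<lambda>t. indicator {0..} t * t powr (\<alpha> - 1) / exp t / Gamma \<alpha>) = ?f"
    by (auto simp: fun_eq_iff gamma_weight_def indicator_def exp_minus field_simps)
  finally have f: "has_bochner_integral lborel ?f 1" .
  have "has_bochner_integral lborel (\<lambda>t. ?f (0 + p * t)) (1 /\<^sub>R \<bar>p\<bar>)"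
    using f assms(2) by (subst (asm) lborel_has_bochner_integral_real_affine_iff[of p _ _ 0]) auto
  then have "has_bochner_integral lborel (\<lambda>t. p powr (1 - \<alpha>) * ?f (0 + p * t)) (p powr (1 - \<alpha>) * (1 / p))"
    using assms(2) by (intro has_bochner_integral_mult_right) (auto simp: divide_inverse)
  also have "(\<lambda>t. p powr (1 - \<alpha>) * ?f (0 + p * t)) = (\<lambda>s. exp (- p * s) * gamma_weight \<alpha> s)"
  proof
    fix t
    have "p powr (1 - \<alpha>) * p powr (\<alpha> - 1) = 1"
      using assms(2) by (simp flip: powr_add)
    then show "p powr (1 - \<alpha>) * ?f (0 + p * t) = exp (- p * t) * gamma_weight \<alpha> t"
      using assms(2) by (auto simp: gamma_weight_def indicator_def zero_less_mult_iff powr_mult)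
  qed
  also have "p powr (1 - \<alpha>) * (1 / p) = p powr (- \<alpha>)"
    using assms(2) by (simp add: powr_diff powr_minus field_simps)
  finally show ?thesis .
qed

text \<open>A truncated parabola in \<open>u = exp (- s)\<close>, positive exactly for
  \<open>a < s < b\<close>. Continuity in \<open>u\<close> makes it accessible to polynomial
  approximation, and an average of a monotone function over such a window is squeezed between the
  values at its ends.\<close>

definition bump :: "real \<Rightarrow> real \<Rightarrow> real \<Rightarrow> real" where
  "bump a b u = max 0 ((u - exp (- b)) * (exp (- a) - u))"

lemma continuous_bump: "continuous_on UNIV (bump a b)"
  unfolding bump_def by (intro continuous_intros)

lemma bump_exp:
  assumes "a < b"
  shows "0 \<le> bump a b u" "bump a b (exp (- s)) > 0 \<longleftrightarrow> a < s \<and> s < b"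
  using assms by (auto simp: bump_def less_max_iff_disj zero_less_mult_iff)

lemma bump_integral:
  assumes ab: "a < b"
  shows "integrable lborel (\<lambda>s. exp (- s) * bump a b (exp (- s)))"
    and "0 < (\<integral>s. exp (- s) * bump a b (exp (- s)) \<partial>lborel)"
proof -
  have 0: "bump a b (exp (- s)) = 0" if "s \<notin> {a<..<b}" for s
    using bump_exp[OF ab] that by (metis greaterThanLessThan_iff order_le_less)
  have "continuous_on {a..b} (\<lambda>s. exp (- s) * bump a b (exp (- s)))"
    unfolding bump_def by (intro continuous_intros)
  then have "set_integrable lborel {a..b} (\<lambda>s. exp (- s) * bump a b (exp (- s)))"
    by (rule borel_integrable_atLeastAtMost')
  also have "set_integrable lborel {a..b} (\<lambda>s. exp (- s) * bump a b (exp (- s))) \<longleftrightarrow>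
      integrable lborel (\<lambda>s. exp (- s) * bump a b (exp (- s)))"
    unfolding set_integrable_def
    using 0 by (intro arg_cong[where f="integrable lborel"] ext)
      (metis (no_types, lifting) atLeastAtMost_iff greaterThanLessThan_iff indicator_simps(1,2) less_imp_le
        mult_zero_right scaleR_one scaleR_zero_left)
  finally show int: "integrable lborel (\<lambda>s. exp (- s) * bump a b (exp (- s)))" .
  have "(\<integral>s. exp (- s) * bump a b (exp (- s)) \<partial>lborel) \<noteq> 0"
  proof
    assume "(\<integral>s. exp (- s) * bump a b (exp (- s)) \<partial>lborel) = 0"
    then have "AE s in lborel. exp (- s) * bump a b (exp (- s)) = 0"
      using integral_nonneg_eq_0_iff_AE[OF int] bump_exp(1)[OF ab] by simp
    then have "AE s in lborel. s \<notin> {a<..<b}"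
    proof eventually_elim
      case (elim s)
      then show ?case using bump_exp(2)[OF ab, of s] by simp
    qed
    then have "emeasure lborel {a<..<b} = 0"
      using AE_iff_null_sets[of "{a<..<b}" lborel] by (auto simp: null_sets_def)
    then show False using ab by simp
  qed
  moreover have "0 \<le> (\<integral>s. exp (- s) * bump a b (exp (- s)) \<partial>lborel)"
    using bump_exp(1)[OF ab] by (intro integral_nonneg_AE) simp
  ultimately show "0 < (\<integral>s. exp (- s) * bump a b (exp (- s)) \<partial>lborel)" by simp
qed

section \<open>Karamata's theorem for a monotone density\<close>

locale karamata =
  fixes V :: "real \<Rightarrow> real" and F :: "real filter" and \<alpha> :: real
  assumes V_mono: "mono V" and V_nonpos: "t \<le> 0 \<Longrightarrow> V t = 0"
    and V_int: "x > 0 \<Longrightarrow> integrable lborel (\<lambda>t. exp (- x * t) * V t)"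
    and V_pos: "x > 0 \<Longrightarrow> 0 < (\<integral>t. exp (- x * t) * V t \<partial>lborel)"
    and F_pos: "\<forall>\<^sub>F x in F. x > 0"
    and \<alpha>: "\<alpha> > 0"
    and ratio: "((\<lambda>x. (\<integral>t. exp (- (real (Suc n) * x) * t) * V t \<partial>lborel) /
        (\<integral>t. exp (- x * t) * V t \<partial>lborel)) \<longlongrightarrow> real (Suc n) powr (- \<alpha>)) F"
begin

lemma V_nonneg: "0 \<le> V t"
  using V_mono V_nonpos[of 0] V_nonpos[of t] by (cases "t \<le> 0") (auto simp: mono_def dest: spec[of _ 0])

lemma measurable_V [measurable]: "V \<in> borel_measurable borel"
  by (rule borel_measurable_mono[OF V_mono])

definition transform :: "real \<Rightarrow> real" where
  "transform x = (\<integral>t. exp (- x * t) * V t \<partial>lborel)"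

text \<open>The measures \<open>exp (- x t) V t dt / transform x\<close> are pushed forward along
  \<open>u = exp (- x t)\<close> to probability measures on the unit interval, whose moments are ratios of
  values of the transform.\<close>

definition scaled :: "real \<Rightarrow> (real \<Rightarrow> real) \<Rightarrow> real" where
  "scaled x f = (\<integral>t. exp (- x * t) * f (exp (- x * t)) * V t \<partial>lborel) / transform x"

definition limit :: "(real \<Rightarrow> real) \<Rightarrow> real" where
  "limit f = (\<integral>s. exp (- s) * f (exp (- s)) * gamma_weight \<alpha> s \<partial>lborel)"

lemma scaled_integrable:
  assumes "continuous_on UNIV f" "x > 0"
  shows "integrable lborel (\<lambda>t. exp (- x * t) * f (exp (- x * t)) * V t)"
proof -
  have [measurable]: "f \<in> borel_measurable borel"
    using assms(1) by (rule borel_measurable_continuous_onI)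
  have "continuous_on {0..1::real} f" using assms(1) continuous_on_subset by blast
  then obtain B where B: "\<And>u. u \<in> {0..1} \<Longrightarrow> \<bar>f u\<bar> \<le> B"
    using compact_continuous_image[of "{0..1}" f] compact_imp_bounded
    by (metis bounded_iff compact_Icc image_eqI real_norm_def)
  show ?thesis
  proof (rule Bochner_Integration.integrable_bound)
    show "integrable lborel (\<lambda>t. B * (exp (- x * t) * V t))"
      using V_int[OF assms(2)] by simp
    show "AE t in lborel. norm (exp (- x * t) * f (exp (- x * t)) * V t) \<le> norm (B * (exp (- x * t) * V t))"
    proof (intro always_eventually allI)
      fix t
      show "norm (exp (- x * t) * f (exp (- x * t)) * V t) \<le> norm (B * (exp (- x * t) * V t))"
      proof (cases "t > 0")
        case True
        then have "\<bar>f (exp (- x * t))\<bar> \<le> \<bar>B\<bar>"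
          using B[of "exp (- x * t)"] assms(2) by (simp add: order_trans[OF _ abs_ge_self])
        then show ?thesis
          using V_nonneg[of t] by (simp add: abs_mult mult_right_mono mult.left_commute mult.assoc)
      qed (simp add: V_nonpos)
    qed
  qed measurable
qed

lemma limit_integrable:
  assumes "continuous_on UNIV f"
  shows "integrable lborel (\<lambda>s. exp (- s) * f (exp (- s)) * gamma_weight \<alpha> s)"
proof -
  have [measurable]: "f \<in> borel_measurable borel"
    using assms(1) by (rule borel_measurable_continuous_onI)
  have "continuous_on {0..1::real} f" using assms(1) continuous_on_subset by blast
  then obtain B where B: "\<And>u. u \<in> {0..1} \<Longrightarrow> \<bar>f u\<bar> \<le> B"
    using compact_continuous_image[of "{0..1}" f] compact_imp_bounded
    by (metis bounded_iff compact_Icc image_eqI real_norm_def)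
  show ?thesis
  proof (rule Bochner_Integration.integrable_bound)
    show "integrable lborel (\<lambda>s. B * (exp (- s) * gamma_weight \<alpha> s))"
      using has_bochner_integral_gamma_weight[OF \<alpha>, of 1] by (auto simp: has_bochner_integral_iff)
    show "AE s in lborel. norm (exp (- s) * f (exp (- s)) * gamma_weight \<alpha> s) \<le> norm (B * (exp (- s) * gamma_weight \<alpha> s))"
    proof (intro always_eventually allI)
      fix s
      show "norm (exp (- s) * f (exp (- s)) * gamma_weight \<alpha> s) \<le> norm (B * (exp (- s) * gamma_weight \<alpha> s))"
      proof (cases "s > 0")
        case True
        then have "\<bar>f (exp (- s))\<bar> \<le> \<bar>B\<bar>"
          using B[of "exp (- s)"] by (simp add: order_trans[OF _ abs_ge_self])
        then show ?thesis
          using gamma_weight_nonneg[OF \<alpha>, of s] by (simp add: abs_mult mult_right_mono mult.left_commute mult.assoc)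
      qed (simp add: gamma_weight_def)
    qed
  qed measurable
qed

lemma transform_pos: "x > 0 \<Longrightarrow> transform x > 0"
  unfolding transform_def by (rule V_pos)

text \<open>An average against a measure of mass one is a contraction for the supremum norm on the
  unit interval. The bound is uniform in \<open>x\<close>, so approximation and passage to the limit
  can be interchanged.\<close>

lemma scaled_close:
  assumes "continuous_on UNIV f" "continuous_on UNIV g" "x > 0"
    and "\<And>u. u \<in> {0..1} \<Longrightarrow> \<bar>f u - g u\<bar> \<le> e"
  shows "\<bar>scaled x f - scaled x g\<bar> \<le> e"
proof -
  have "\<bar>(\<integral>t. exp (- x * t) * f (exp (- x * t)) * V t \<partial>lborel) - (\<integral>t. exp (- x * t) * g (exp (- x * t)) * V t \<partial>lborel)\<bar>
      = \<bar>\<integral>t. exp (- x * t) * f (exp (- x * t)) * V t - exp (- x * t) * g (exp (- x * t)) * V t \<partial>lborel\<bar>"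
    using scaled_integrable assms by simp
  also have "\<dots> \<le> (\<integral>t. \<bar>exp (- x * t) * f (exp (- x * t)) * V t - exp (- x * t) * g (exp (- x * t)) * V t\<bar> \<partial>lborel)"
    by (rule integral_abs_bound)
  also have "\<dots> \<le> (\<integral>t. e * (exp (- x * t) * V t) \<partial>lborel)"
  proof (rule integral_mono)
    fix t
    show "\<bar>exp (- x * t) * f (exp (- x * t)) * V t - exp (- x * t) * g (exp (- x * t)) * V t\<bar> \<le> e * (exp (- x * t) * V t)"
    proof (cases "t > 0")
      case True
      have "exp (- x * t) * f (exp (- x * t)) * V t - exp (- x * t) * g (exp (- x * t)) * V t =
          (f (exp (- x * t)) - g (exp (- x * t))) * (exp (- x * t) * V t)"
        by (simp add: algebra_simps)
      then have "\<bar>exp (- x * t) * f (exp (- x * t)) * V t - exp (- x * t) * g (exp (- x * t)) * V t\<bar> =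
          \<bar>f (exp (- x * t)) - g (exp (- x * t))\<bar> * (exp (- x * t) * V t)"
        using V_nonneg[of t] by (simp add: abs_mult)
      also have "\<dots> \<le> e * (exp (- x * t) * V t)"
        using True assms V_nonneg[of t] by (intro mult_right_mono) auto
      finally show ?thesis .
    qed (simp add: V_nonpos)
  qed (use scaled_integrable V_int assms in auto)
  also have "\<dots> = e * transform x" by (simp add: transform_def)
  finally show ?thesis
    using transform_pos[OF assms(3)] by (simp add: scaled_def flip: diff_divide_distrib) (simp add: divide_le_eq)
qed

lemma limit_close:
  assumes "continuous_on UNIV f" "continuous_on UNIV g"
    and "\<And>u. u \<in> {0..1} \<Longrightarrow> \<bar>f u - g u\<bar> \<le> e"
  shows "\<bar>limit f - limit g\<bar> \<le> e"
proof -
  have "\<bar>limit f - limit g\<bar>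
      = \<bar>\<integral>s. exp (- s) * f (exp (- s)) * gamma_weight \<alpha> s - exp (- s) * g (exp (- s)) * gamma_weight \<alpha> s \<partial>lborel\<bar>"
    using limit_integrable assms by (simp add: limit_def)
  also have "\<dots> \<le> (\<integral>s. \<bar>exp (- s) * f (exp (- s)) * gamma_weight \<alpha> s - exp (- s) * g (exp (- s)) * gamma_weight \<alpha> s\<bar> \<partial>lborel)"
    by (rule integral_abs_bound)
  also have "\<dots> \<le> (\<integral>s. e * (exp (- s) * gamma_weight \<alpha> s) \<partial>lborel)"
  proof (rule integral_mono)
    fix s
    show "\<bar>exp (- s) * f (exp (- s)) * gamma_weight \<alpha> s - exp (- s) * g (exp (- s)) * gamma_weight \<alpha> s\<bar> \<le> e * (exp (- s) * gamma_weight \<alpha> s)"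
    proof (cases "s > 0")
      case True
      have "exp (- s) * f (exp (- s)) * gamma_weight \<alpha> s - exp (- s) * g (exp (- s)) * gamma_weight \<alpha> s =
          (f (exp (- s)) - g (exp (- s))) * (exp (- s) * gamma_weight \<alpha> s)"
        by (simp add: algebra_simps)
      then have "\<bar>exp (- s) * f (exp (- s)) * gamma_weight \<alpha> s - exp (- s) * g (exp (- s)) * gamma_weight \<alpha> s\<bar> =
          \<bar>f (exp (- s)) - g (exp (- s))\<bar> * (exp (- s) * gamma_weight \<alpha> s)"
        using gamma_weight_nonneg[OF \<alpha>, of s] by (simp add: abs_mult)
      also have "\<dots> \<le> e * (exp (- s) * gamma_weight \<alpha> s)"
        using True assms gamma_weight_nonneg[OF \<alpha>, of s] by (intro mult_right_mono) auto
      finally show ?thesis .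
    qed (simp add: gamma_weight_def)
  qed (use limit_integrable has_bochner_integral_gamma_weight[OF \<alpha>, of 1] assms in \<open>auto simp: has_bochner_integral_iff\<close>)
  also have "\<dots> = e"
    using has_bochner_integral_gamma_weight[OF \<alpha>, of 1] by (auto simp: has_bochner_integral_iff)
  finally show ?thesis .
qed

lemma exp_power_Suc: "exp (- (y::real)) * exp (- y) ^ i = exp (- (real (Suc i) * y))"
proof -
  have "exp (- y) * exp (- y) ^ i = exp (- y) ^ Suc i" by simp
  also have "\<dots> = exp (real (Suc i) * (- y))" by (rule exp_of_nat_mult[symmetric])
  finally show ?thesis by simp
qed

text \<open>The factor \<open>exp (- x * t)\<close> built into \<open>scaled\<close> turns
  \<open>u ^ i\<close> into \<open>exp (- (Suc i * x) * t)\<close>. Hence the \<open>i\<close>-th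
  moment is a ratio of transforms at \<open>Suc i * x\<close> and \<open>x\<close>, and
  \<open>ratio\<close> is convergence of moments; only integer multiples of \<open>x\<close>
  arise.\<close>

lemma scaled_polynomial_tendsto:
  "((\<lambda>x. scaled x (\<lambda>u. \<Sum>i\<le>n. c i * u ^ i)) \<longlongrightarrow> limit (\<lambda>u. \<Sum>i\<le>n. c i * u ^ i)) F"
proof -
  have L: "limit (\<lambda>u. \<Sum>i\<le>n. c i * u ^ i) = (\<Sum>i\<le>n. c i * real (Suc i) powr (- \<alpha>))"
  proof -
    have "limit (\<lambda>u. \<Sum>i\<le>n. c i * u ^ i) =
        (\<integral>s. (\<Sum>i\<le>n. c i * (exp (- real (Suc i) * s) * gamma_weight \<alpha> s)) \<partial>lborel)"
      unfolding limit_def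
    proof (intro Bochner_Integration.integral_cong refl)
      fix s
      have eq: "exp (- s) * (c i * exp (- s) ^ i) * gamma_weight \<alpha> s =
          c i * (exp (- real (Suc i) * s) * gamma_weight \<alpha> s)" for i
        using exp_power_Suc[of s i] by (simp add: mult.left_commute del: of_nat_Suc)
      show "exp (- s) * (\<Sum>i\<le>n. c i * exp (- s) ^ i) * gamma_weight \<alpha> s =
          (\<Sum>i\<le>n. c i * (exp (- real (Suc i) * s) * gamma_weight \<alpha> s))"
        unfolding sum_distrib_left sum_distrib_right by (intro sum.cong refl eq)
    qed
    also have "\<dots> = (\<Sum>i\<le>n. c i * real (Suc i) powr (- \<alpha>))"
      using has_bochner_integral_gamma_weight[OF \<alpha>]
      by (subst Bochner_Integration.integral_sum) (auto simp: has_bochner_integral_iff simp del: of_nat_Suc)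
    finally show ?thesis .
  qed
  have S: "scaled x (\<lambda>u. \<Sum>i\<le>n. c i * u ^ i) = (\<Sum>i\<le>n. c i * (transform (real (Suc i) * x) / transform x))"
    if "x > 0" for x
  proof -
    have "(\<integral>t. exp (- x * t) * (\<Sum>i\<le>n. c i * exp (- x * t) ^ i) * V t \<partial>lborel) =
        (\<integral>t. (\<Sum>i\<le>n. c i * (exp (- (real (Suc i) * x) * t) * V t)) \<partial>lborel)"
    proof (intro Bochner_Integration.integral_cong refl)
      fix t
      have eq: "exp (- x * t) * (c i * exp (- x * t) ^ i) * V t =
          c i * (exp (- (real (Suc i) * x) * t) * V t)" for i
        using exp_power_Suc[of "x * t" i] by (simp add: mult.left_commute mult.assoc del: of_nat_Suc)
      show "exp (- x * t) * (\<Sum>i\<le>n. c i * exp (- x * t) ^ i) * V t = (\<Sum>i\<le>n. c i * (exp (- (real (Suc i) * x) * t) * V t))"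
        unfolding sum_distrib_left sum_distrib_right by (intro sum.cong refl eq)
    qed
    also have "\<dots> = (\<Sum>i\<le>n. c i * transform (real (Suc i) * x))"
      using V_int[of "real (Suc i) * x" for i] that
      by (subst Bochner_Integration.integral_sum) (auto simp: transform_def simp del: of_nat_Suc)
    finally show ?thesis by (simp add: scaled_def sum_divide_distrib)
  qed
  have "((\<lambda>x. \<Sum>i\<le>n. c i * (transform (real (Suc i) * x) / transform x)) \<longlongrightarrow> (\<Sum>i\<le>n. c i * real (Suc i) powr (- \<alpha>))) F"
    unfolding transform_def by (intro tendsto_intros ratio)
  then show ?thesis
    unfolding L by (rule Lim_transform_eventually) (use F_pos in \<open>eventually_elim, simp add: S\<close>)
qed

text \<open>Weierstrass approximation on the unit interval upgrades convergence of moments to weak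
  convergence of the measures.\<close>

lemma scaled_tendsto:
  assumes f: "continuous_on UNIV f"
  shows "((\<lambda>x. scaled x f) \<longlongrightarrow> limit f) F"
proof (rule tendstoI)
  fix e :: real assume e: "e > 0"
  have "continuous_on {0..1::real} f" using f continuous_on_subset by blast
  then obtain g where g: "real_polynomial_function g" "\<And>u. u \<in> {0..1} \<Longrightarrow> \<bar>f u - g u\<bar> < e / 3"
    using Stone_Weierstrass_real_polynomial_function[of "{0..1::real}" f "e / 3"] e by auto
  then obtain c n where gc: "g = (\<lambda>u. \<Sum>i\<le>n. c i * u ^ i)"
    using real_polynomial_function_iff_sum by blast
  have cg: "continuous_on UNIV g" unfolding gc by (intro continuous_intros)
  have le: "\<bar>f u - g u\<bar> \<le> e / 3" if "u \<in> {0..1}" for u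
    using g(2)[OF that] by simp
  have "\<forall>\<^sub>F x in F. dist (scaled x g) (limit g) < e / 3"
    unfolding gc using e by (intro tendstoD[OF scaled_polynomial_tendsto]) simp
  then show "\<forall>\<^sub>F x in F. dist (scaled x f) (limit f) < e"
    using F_pos
  proof eventually_elim
    case (elim x)
    have "\<bar>scaled x f - scaled x g\<bar> \<le> e / 3" by (rule scaled_close[OF f cg elim(2) le])
    moreover have "\<bar>limit f - limit g\<bar> \<le> e / 3" by (rule limit_close[OF f cg le])
    ultimately show ?case using elim(1) unfolding dist_real_def by linarith
  qed
qed

text \<open>In the variable \<open>t\<close> the bump is supported between \<open>a / x\<close> and
  \<open>b / x\<close>, where monotonicity bounds \<open>V\<close> by its values at the two ends.
  The substitution \<open>s = x * t\<close> gives the bump the total mass \<open>J / x\<close>,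
  which produces the factor \<open>x\<close> in the denominators.\<close>

lemma scaled_bump_bounds:
  assumes ab: "a < b" and x: "x > 0"
  defines "J \<equiv> \<integral>s. exp (- s) * bump a b (exp (- s)) \<partial>lborel"
  shows "V (a / x) / (x * transform x) \<le> scaled x (bump a b) / J"
    and "scaled x (bump a b) / J \<le> V (b / x) / (x * transform x)"
proof -
  let ?\<phi> = "\<lambda>s. exp (- s) * bump a b (exp (- s))"
  have J: "J > 0" unfolding J_def by (rule bump_integral(2)[OF ab])
  have int: "integrable lborel (\<lambda>t. ?\<phi> (x * t))"
    using lborel_integrable_real_affine[OF bump_integral(1)[OF ab], of x 0] x by simp
  have Jx: "(\<integral>t. ?\<phi> (x * t) \<partial>lborel) = J / x"
    unfolding J_def using lborel_integral_real_affine[of x ?\<phi> 0] x by simp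
  have int2: "integrable lborel (\<lambda>t. ?\<phi> (x * t) * V t)"
    using scaled_integrable[OF continuous_bump x] by simp
  have sc: "scaled x (bump a b) = (\<integral>t. ?\<phi> (x * t) * V t \<partial>lborel) / transform x"
    by (simp add: scaled_def)
  have mono: "?\<phi> (x * t) * V (a / x) \<le> ?\<phi> (x * t) * V t \<and> ?\<phi> (x * t) * V t \<le> ?\<phi> (x * t) * V (b / x)" for t
  proof (cases "bump a b (exp (- (x * t))) > 0")
    case True
    then have "a < x * t" "x * t < b" using bump_exp(2)[OF ab] by auto
    then have "a / x \<le> t" "t \<le> b / x" using x by (auto simp: field_simps)
    then show ?thesis
      using True V_mono by (auto simp: mono_def intro!: mult_left_mono)
  next
    case False
    then have "bump a b (exp (- (x * t))) = 0"
      using bump_exp(1)[OF ab] by (metis order_le_less)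
    then show ?thesis by simp
  qed
  have "J / x * V (a / x) = (\<integral>t. ?\<phi> (x * t) * V (a / x) \<partial>lborel)"
    by (simp only: integral_mult_left_zero Jx)
  also have "\<dots> \<le> (\<integral>t. ?\<phi> (x * t) * V t \<partial>lborel)"
    by (intro integral_mono int2 integrable_mult_left int) (use mono in blast)
  finally show "V (a / x) / (x * transform x) \<le> scaled x (bump a b) / J"
    using J x transform_pos[OF x] by (simp add: sc field_simps)
  have "(\<integral>t. ?\<phi> (x * t) * V t \<partial>lborel) \<le> (\<integral>t. ?\<phi> (x * t) * V (b / x) \<partial>lborel)"
    by (intro integral_mono int2 integrable_mult_left int) (use mono in blast)
  also have "\<dots> = J / x * V (b / x)"
    by (simp only: integral_mult_left_zero Jx)
  finally show "scaled x (bump a b) / J \<le> V (b / x) / (x * transform x)"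
    using J x transform_pos[OF x] by (simp add: sc field_simps)
qed

lemma limit_bump_bounds:
  assumes ab: "a < b"
  defines "J \<equiv> \<integral>s. exp (- s) * bump a b (exp (- s)) \<partial>lborel"
  shows "(\<And>s. a < s \<Longrightarrow> s < b \<Longrightarrow> gamma_weight \<alpha> s \<le> C) \<Longrightarrow> limit (bump a b) / J \<le> C"
    and "(\<And>s. a < s \<Longrightarrow> s < b \<Longrightarrow> C \<le> gamma_weight \<alpha> s) \<Longrightarrow> C \<le> limit (bump a b) / J"
proof -
  let ?\<phi> = "\<lambda>s. exp (- s) * bump a b (exp (- s))"
  have J: "J > 0" unfolding J_def by (rule bump_integral(2)[OF ab])
  have zero: "bump a b (exp (- s)) = 0" if "\<not> (a < s \<and> s < b)" for s
    using bump_exp[OF ab] that by (metis order_le_less)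
  have JC: "(\<integral>s. ?\<phi> s * C \<partial>lborel) = J * C"
    by (simp only: integral_mult_left_zero J_def)
  show "limit (bump a b) / J \<le> C" if C: "\<And>s. a < s \<Longrightarrow> s < b \<Longrightarrow> gamma_weight \<alpha> s \<le> C"
  proof -
    have "limit (bump a b) \<le> (\<integral>s. ?\<phi> s * C \<partial>lborel)"
      unfolding limit_def
    proof (intro integral_mono limit_integrable continuous_bump integrable_mult_left bump_integral[OF ab])
      show "?\<phi> s * gamma_weight \<alpha> s \<le> ?\<phi> s * C" for s
        using C[of s] zero[of s] bump_exp(1)[OF ab] by (cases "a < s \<and> s < b") (auto intro!: mult_left_mono)
    qed
    then show ?thesis using J unfolding JC by (simp add: field_simps)
  qed
  show "C \<le> limit (bump a b) / J" if C: "\<And>s. a < s \<Longrightarrow> s < b \<Longrightarrow> C \<le> gamma_weight \<alpha> s"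
  proof -
    have "(\<integral>s. ?\<phi> s * C \<partial>lborel) \<le> limit (bump a b)"
      unfolding limit_def
    proof (intro integral_mono limit_integrable continuous_bump integrable_mult_left bump_integral[OF ab])
      show "?\<phi> s * C \<le> ?\<phi> s * gamma_weight \<alpha> s" for s
        using C[of s] zero[of s] bump_exp(1)[OF ab] by (cases "a < s \<and> s < b") (auto intro!: mult_left_mono)
    qed
    then show ?thesis using J unfolding JC by (simp add: field_simps)
  qed
qed

lemma gamma_weight_near_1:
  "(gamma_weight \<alpha> \<longlongrightarrow> 1 / Gamma \<alpha>) (nhds 1)"
proof -
  have "((\<lambda>s. s powr (\<alpha> - 1) / Gamma \<alpha>) \<longlongrightarrow> 1 powr (\<alpha> - 1) / Gamma \<alpha>) (nhds 1)"
    by (intro tendsto_intros filterlim_ident) (use Gamma_real_pos[OF \<alpha>] in auto)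
  then have "((\<lambda>s. s powr (\<alpha> - 1) / Gamma \<alpha>) \<longlongrightarrow> 1 / Gamma \<alpha>) (nhds 1)"
    by simp
  moreover have "\<forall>\<^sub>F s in nhds (1::real). s powr (\<alpha> - 1) / Gamma \<alpha> = gamma_weight \<alpha> s"
  proof -
    have "\<forall>\<^sub>F s in nhds (1::real). s \<in> {0<..}"
      by (rule eventually_nhds_in_open) auto
    then show ?thesis by eventually_elim (simp add: gamma_weight_def)
  qed
  ultimately show ?thesis
    by (rule Lim_transform_eventually)
qed

text \<open>The value \<open>V (1 / x)\<close> is bounded above by an average over the window from 1
  to \<open>1 + d\<close> and below by one over the window from \<open>1 - d\<close> to 1. In the
  limit these become averages of \<open>gamma_weight \<alpha>\<close>, which is continuous at 1, so
  a small \<open>d\<close> brings both as close to \<open>1 / Gamma \<alpha>\<close> as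
  desired.\<close>

theorem karamata: "((\<lambda>x. V (1 / x) / (x * transform x)) \<longlongrightarrow> 1 / Gamma \<alpha>) F"
proof (rule order_tendstoI)
  have near: "\<exists>d>0. \<forall>s. dist s 1 < d \<longrightarrow> gamma_weight \<alpha> s \<in> S" if "open S" "1 / Gamma \<alpha> \<in> S" for S
    using topological_tendstoD[OF gamma_weight_near_1 that] by (simp add: eventually_nhds_metric)
  have sc: "((\<lambda>x. scaled x (bump a b) / J) \<longlongrightarrow> limit (bump a b) / J) F" if "J \<noteq> 0" for a b J
    by (intro tendsto_intros scaled_tendsto continuous_bump that)
  {
    fix y assume y: "1 / Gamma \<alpha> < y"
    obtain z where z: "1 / Gamma \<alpha> < z" "z < y" using dense[OF y] by blast
    obtain d where d: "d > 0" "\<And>s. dist s 1 < d \<Longrightarrow> gamma_weight \<alpha> s < z"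
      using near[of "{..<z}"] z by auto
    define J where "J = (\<integral>s. exp (- s) * bump 1 (1 + d) (exp (- s)) \<partial>lborel)"
    have J: "J > 0" unfolding J_def using d by (intro bump_integral) simp
    have "limit (bump 1 (1 + d)) / J \<le> z"
      unfolding J_def using d by (intro limit_bump_bounds) (auto simp: dist_real_def less_imp_le)
    then have "limit (bump 1 (1 + d)) / J < y" using z by simp
    then have "\<forall>\<^sub>F x in F. scaled x (bump 1 (1 + d)) / J < y"
      using J by (intro order_tendstoD(2)[OF sc]) auto
    then show "\<forall>\<^sub>F x in F. V (1 / x) / (x * transform x) < y"
      using F_pos
    proof eventually_elim
      case (elim x)
      have "V (1 / x) / (x * transform x) \<le> scaled x (bump 1 (1 + d)) / J"
        unfolding J_def using d elim by (intro scaled_bump_bounds) auto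
      then show ?case using elim by simp
    qed
  }
  {
    fix y assume y: "y < 1 / Gamma \<alpha>"
    obtain z where z: "y < z" "z < 1 / Gamma \<alpha>" using dense[OF y] by blast
    obtain d where d: "d > 0" "\<And>s. dist s 1 < d \<Longrightarrow> z < gamma_weight \<alpha> s"
      using near[of "{z<..}"] z by auto
    define J where "J = (\<integral>s. exp (- s) * bump (1 - d) 1 (exp (- s)) \<partial>lborel)"
    have J: "J > 0" unfolding J_def using d by (intro bump_integral) simp
    have "z \<le> limit (bump (1 - d) 1) / J"
      unfolding J_def using d by (intro limit_bump_bounds) (auto simp: dist_real_def less_imp_le)
    then have "y < limit (bump (1 - d) 1) / J" using z by simp
    then have "\<forall>\<^sub>F x in F. y < scaled x (bump (1 - d) 1) / J"
      using J by (intro order_tendstoD(1)[OF sc]) auto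
    then show "\<forall>\<^sub>F x in F. y < V (1 / x) / (x * transform x)"
      using F_pos
    proof eventually_elim
      case (elim x)
      have "scaled x (bump (1 - d) 1) / J \<le> V (1 / x) / (x * transform x)"
        unfolding J_def using d elim by (intro scaled_bump_bounds) auto
      then show ?case using elim by simp
    qed
  }
qed

end

subsection \<open>The variance of the telegraph process\<close>

text \<open>Local integrability on the half-line for extended nonnegative functions. The class is
  closed under \<open>nn_conv\<close>, and its members are finite almost everywhere; this supplies
  the finiteness conditions for real convolutions.\<close>

definition causal_L1 :: "(real \<Rightarrow> ennreal) \<Rightarrow> bool" where
  "causal_L1 f \<longleftrightarrow> f \<in> borel_measurable borel \<and> (\<forall>t\<le>0. f t = 0) \<and>
     (\<forall>T. (\<integral>\<^sup>+t. indicator {..T} t * f t \<partial>lborel) < \<infinity>)"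

lemma nn_conv_nonpos:
  assumes "\<And>t. t \<le> 0 \<Longrightarrow> f t = 0" "\<And>t. t \<le> 0 \<Longrightarrow> g t = 0" "t \<le> 0"
  shows "nn_conv f g t = 0"
proof -
  have *: "f (t - s) * g s = 0" for s
    using assms(1)[of "t - s"] assms(2)[of s] assms(3) by (cases "s \<le> 0") auto
  show ?thesis unfolding nn_conv_def * by simp
qed

lemma lconv_nonpos:
  assumes "\<And>t. t \<le> 0 \<Longrightarrow> f t = 0" "\<And>t. t \<le> 0 \<Longrightarrow> g t = 0" "t \<le> 0"
  shows "lconv f g t = 0"
proof -
  have *: "f (t - s) * g s = 0" for s
    using assms(1)[of "t - s"] assms(2)[of s] assms(3) by (cases "s \<le> 0") auto
  show ?thesis unfolding lconv_def * by simp
qed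

lemma causal_L1_nn_conv:
  assumes f: "causal_L1 f" and g: "causal_L1 g"
  shows "causal_L1 (nn_conv f g)"
proof -
  have [measurable]: "f \<in> borel_measurable borel" "g \<in> borel_measurable borel"
    using f g by (auto simp: causal_L1_def)
  have "(\<integral>\<^sup>+t. indicator {..T} t * nn_conv f g t \<partial>lborel) < \<infinity>" for T
  proof -
    have "(\<integral>\<^sup>+t. indicator {..T} t * nn_conv f g t \<partial>lborel)
        \<le> (\<integral>\<^sup>+t. indicator {..T} t * f t \<partial>lborel) * (\<integral>\<^sup>+t. indicator {..T} t * g t \<partial>lborel)"
      using f g by (intro nn_integral_nn_conv_le) (auto simp: causal_L1_def)
    also have "\<dots> < \<infinity>" using f g by (auto simp: causal_L1_def ennreal_mult_less_top)
    finally show ?thesis .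
  qed
  then show ?thesis
    using f g nn_conv_nonpos[of f g] by (auto simp: causal_L1_def)
qed

lemma causal_L1_AE_finite:
  assumes "causal_L1 f"
  shows "AE t in lborel. f t < \<infinity>"
proof -
  have [measurable]: "f \<in> borel_measurable borel" using assms by (simp add: causal_L1_def)
  have "AE t in lborel. indicator {..real n} t * f t \<noteq> \<infinity>" for n :: nat
    using assms by (intro nn_integral_PInf_AE) (auto simp: causal_L1_def less_top)
  then have "AE t in lborel. \<forall>n::nat. indicator {..real n} t * f t \<noteq> \<infinity>"
    by (simp add: AE_all_countable)
  then show ?thesis
  proof eventually_elim
    case (elim t)
    obtain n :: nat where "t \<le> real n" using real_arch_simple by blast
    then show ?case using elim[rule_format, of n] by (simp add: less_top)
  qed
qed

lemma causal_L1_abs: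
  assumes "L1_loc f"
  shows "causal_L1 (\<lambda>t. ennreal \<bar>causal f t\<bar>)"
proof -
  have "(\<integral>\<^sup>+t. indicator {..T} t * ennreal \<bar>causal f t\<bar> \<partial>lborel) < \<infinity>" for T
  proof -
    have "(\<integral>\<^sup>+t. indicator {..T} t * ennreal \<bar>causal f t\<bar> \<partial>lborel) =
        (\<integral>\<^sup>+t. ennreal (norm (indicator {..T} t * causal f t)) \<partial>lborel)"
      by (intro nn_integral_cong) (auto simp: indicator_def)
    also have "\<dots> < \<infinity>"
      using L1_loc_causal(2)[OF assms, of T] unfolding integrable_iff_bounded by simp
    finally show ?thesis .
  qed
  then show ?thesis
    using L1_loc_causal(1)[OF assms] by (auto simp: causal_L1_def)
qed

lemma integrable_lconv:
  assumes [measurable]: "f \<in> borel_measurable borel" "g \<in> borel_measurable borel"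
    and "nn_conv (\<lambda>t. ennreal \<bar>f t\<bar>) (\<lambda>t. ennreal \<bar>g t\<bar>) t < \<infinity>"
  shows "integrable lborel (\<lambda>s. f (t - s) * g s)"
  using assms(3) by (intro integrableI_bounded) (auto simp: nn_conv_def abs_mult ennreal_mult)

text \<open>True at every \<open>t\<close>: where the real convolution diverges, its value is 0 by
  convention.\<close>

lemma ennreal_abs_lconv_le:
  "ennreal \<bar>lconv f g t\<bar> \<le> nn_conv (\<lambda>t. ennreal \<bar>f t\<bar>) (\<lambda>t. ennreal \<bar>g t\<bar>) t"
proof (cases "integrable lborel (\<lambda>s. f (t - s) * g s)")
  case True
  then show ?thesis
    using integral_norm_bound_ennreal[OF True] by (simp add: lconv_def nn_conv_def abs_mult ennreal_mult)
qed (simp add: lconv_def not_integrable_integral_eq)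

text \<open>In the divergent case both sides are 0, the left as the default value of the Bochner
  integral, the right because \<open>enn2real\<close> sends infinity to 0.\<close>

lemma lconv_eq_enn2real:
  assumes [measurable]: "f \<in> borel_measurable borel" "g \<in> borel_measurable borel"
    and "AE t in lborel. 0 \<le> f t" "AE t in lborel. 0 \<le> g t"
  shows "lconv f g t = enn2real (nn_conv (\<lambda>t. ennreal (f t)) (\<lambda>t. ennreal (g t)) t)"
proof -
  have "AE s in lborel. 0 \<le> f (t + (-1) * s)"
    by (rule AE_borel_affine) (use assms in auto)
  then have ae: "AE s in lborel. 0 \<le> f (t - s) \<and> 0 \<le> g s"
    using assms(4) by eventually_elim simp
  have "lconv f g t = enn2real (\<integral>\<^sup>+s. ennreal (f (t - s) * g s) \<partial>lborel)"
    unfolding lconv_def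
  proof (rule integral_eq_nn_integral)
    show "AE s in lborel. 0 \<le> f (t - s) * g s" using ae by eventually_elim simp
  qed measurable
  also have "(\<integral>\<^sup>+s. ennreal (f (t - s) * g s) \<partial>lborel) = nn_conv (\<lambda>t. ennreal (f t)) (\<lambda>t. ennreal (g t)) t"
    unfolding nn_conv_def
  proof (rule nn_integral_cong_AE)
    show "AE s in lborel. ennreal (f (t - s) * g s) = ennreal (f (t - s)) * ennreal (g s)"
      using ae by eventually_elim (simp add: ennreal_mult)
  qed
  finally show ?thesis .
qed

lemma L1_loc_const: "L1_loc (\<lambda>_. c)"
  unfolding L1_loc_def set_integrable_def by (auto simp: emeasure_lborel_Icc_eq intro!: integrable_real_indicator)

lemma monotone_kernel_causal:
  assumes "L1_loc k" and "\<And>t. t > 0 \<Longrightarrow> 0 \<le> k t" and "antimono_on {0<..} k"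
  shows "monotone_kernel (causal k)"
proof
  show "causal k \<in> borel_measurable borel" "integrable lborel (\<lambda>t. indicator {..T} t * causal k t)" for T
    using L1_loc_causal[OF assms(1)] by auto
  show "0 \<le> causal k t" for t using assms(2) by (cases "t > 0") auto
  show "causal k t \<le> causal k s" if "0 < s" "s \<le> t" for s t
    using that monotone_onD[OF assms(3), of s t] by simp
qed simp

lemma nn_laplace_one:
  assumes "x > 0"
  shows "nn_laplace (\<lambda>t. ennreal (causal (\<lambda>_. 1) t)) x = ennreal (1 / x)"
proof -
  have "has_bochner_integral lborel (\<lambda>s. exp (- x * s) * gamma_weight 1 s) (x powr (- 1))"
    by (rule has_bochner_integral_gamma_weight) (use assms in auto)
  also have "(\<lambda>s. exp (- x * s) * gamma_weight 1 s) = (\<lambda>s. exp (- x * s) * causal (\<lambda>_. 1) s)"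
    by (auto simp: fun_eq_iff gamma_weight_def causal_def indicator_def)
  finally have *: "has_bochner_integral lborel (\<lambda>s. exp (- x * s) * causal (\<lambda>_. 1) s) (x powr (- 1))" .
  have "nn_laplace (\<lambda>t. ennreal (causal (\<lambda>_. 1) t)) x = (\<integral>\<^sup>+t. ennreal (exp (- x * t) * causal (\<lambda>_. 1) t) \<partial>lborel)"
    unfolding nn_laplace_def by (intro nn_integral_cong) (simp add: ennreal_mult' )
  also have "\<dots> = ennreal (\<integral>t. exp (- x * t) * causal (\<lambda>_. 1) t \<partial>lborel)"
    using * by (intro nn_integral_eq_integral) (auto simp: has_bochner_integral_iff causal_def)
  also have "(\<integral>t. exp (- x * t) * causal (\<lambda>_. 1) t \<partial>lborel) = 1 / x"
    using * assms by (simp add: has_bochner_integral_iff powr_minus divide_inverse)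
  finally show ?thesis .
qed

section \<open>Positivity of the resolvent and the transform of the variance\<close>

locale telegraph_kernel =
  fixes k l r :: "real \<Rightarrow> real" and \<eta> :: real
  assumes \<eta>: "\<eta> > 0" and PC: "kernel_PC k l" and res: "is_resolvent \<eta> l r"
begin

lemma L1: "L1_loc k" "L1_loc l" "L1_loc r"
  using PC res by (auto simp: kernel_PC_def is_resolvent_def)

lemma measurable_causal [measurable]: "causal k \<in> borel_measurable borel" "causal l \<in> borel_measurable borel"
  "causal r \<in> borel_measurable borel" "causal (\<lambda>_. c) \<in> borel_measurable borel"
  using L1_loc_causal(1) L1 L1_loc_const by blast+

lemma AE_kl: "AE t in lborel. lconv (causal k) (causal l) t = causal (\<lambda>_. 1) t"
proof -
  have "AE t in lborel. 0 < t \<longrightarrow> conv k l t = 1" using PC by (simp add: kernel_PC_def)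
  then show ?thesis
  proof eventually_elim
    case (elim t)
    then show ?case
      by (cases "0 < t") (auto simp: conv_eq_lconv lconv_nonpos)
  qed
qed

lemma AE_l_nonneg: "AE t in lborel. 0 \<le> causal l t"
proof -
  interpret monotone_kernel "causal k"
    by (rule monotone_kernel_causal) (use PC in \<open>auto simp: kernel_PC_def\<close>)
  have "AE t in lborel. 0 < t \<longrightarrow> lconv (causal k) (causal l) t = 1"
    using AE_kl by eventually_elim simp
  then show ?thesis
    by (intro AE_nonneg) (use L1_loc_causal(2)[OF L1(2)] in auto)
qed

lemma AE_resolvent: "AE t in lborel. causal r t + \<eta> * lconv (causal r) (causal l) t = causal l t"
proof -
  have "AE t in lborel. 0 < t \<longrightarrow> r t + \<eta> * conv r l t = l t" using res by (simp add: is_resolvent_def)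
  then show ?thesis
  proof eventually_elim
    case (elim t)
    then show ?case
      by (cases "0 < t") (auto simp: conv_eq_lconv lconv_nonpos)
  qed
qed

text \<open>Convolving the resolvent equation with \<open>k\<close> shows that \<open>(k + \<eta>, r)\<close> satisfies the same
  hypotheses as \<open>(k, l)\<close>, so \<open>r\<close> is nonnegative as well.\<close>

lemma AE_r_nonneg: "AE t in lborel. 0 \<le> causal r t"
proof -
  let ?k' = "\<lambda>t. k t + \<eta>" and ?abs = "\<lambda>f t. ennreal \<bar>causal f t\<bar>"
  have k': "L1_loc ?k'"
    using L1(1) L1_loc_const[of \<eta>] by (auto simp: L1_loc_def)
  interpret monotone_kernel "causal ?k'"
    by (rule monotone_kernel_causal) (use PC \<eta> k' in \<open>auto simp: kernel_PC_def monotone_on_def intro!: add_nonneg_nonneg\<close>)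
  have split: "causal ?k' t = causal k t + \<eta> * causal (\<lambda>_. 1) t" for t
    by (simp add: causal_def indicator_def)
  \<comment> \<open>The sign of \<open>r\<close> is still open, so associativity and splitting of
    integrals are justified by convolutions of absolute values.\<close>
  have fin: "AE t in lborel. nn_conv (?abs k) (nn_conv (?abs r) (?abs l)) t < \<infinity>"
    "AE t in lborel. nn_conv (?abs k) (nn_conv (?abs l) (?abs r)) t < \<infinity>"
    "AE t in lborel. nn_conv (?abs k) (?abs r) t < \<infinity>"
    "AE t in lborel. nn_conv (?abs (\<lambda>_. 1)) (?abs r) t < \<infinity>"
    by (intro causal_L1_AE_finite causal_L1_nn_conv causal_L1_abs L1 L1_loc_const)+
  have "AE t in lborel. 0 < t \<longrightarrow> lconv (causal ?k') (causal r) t = 1"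
    using fin AE_kl
  proof eventually_elim
    case (elim t)
    have i_kr: "integrable lborel (\<lambda>s. causal k (t - s) * causal r s)"
      and i_1r: "integrable lborel (\<lambda>s. causal (\<lambda>_. 1) (t - s) * causal r s)"
      by (rule integrable_lconv; use elim in simp)+
    have i_krl: "integrable lborel (\<lambda>s. causal k (t - s) * lconv (causal r) (causal l) s)"
    proof (rule integrable_lconv)
      have "nn_conv (?abs k) (\<lambda>t. ennreal \<bar>lconv (causal r) (causal l) t\<bar>) t \<le>
          nn_conv (?abs k) (nn_conv (?abs r) (?abs l)) t"
        unfolding nn_conv_def[of _ _ t]
        by (intro nn_integral_mono mult_left_mono ennreal_abs_lconv_le) simp
      then show "nn_conv (?abs k) (\<lambda>t. ennreal \<bar>lconv (causal r) (causal l) t\<bar>) t < \<infinity>"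
        using elim(1) by (rule le_less_trans)
    qed measurable
    have 1: "lconv (causal k) (lconv (causal r) (causal l)) t = lconv (causal (\<lambda>_. 1)) (causal r) t"
    proof -
      have "lconv (causal k) (lconv (causal r) (causal l)) t = lconv (causal k) (lconv (causal l) (causal r)) t"
      proof -
        have "lconv (causal r) (causal l) = lconv (causal l) (causal r)"
          by (rule ext) (rule lconv_commute)
        then show ?thesis by simp
      qed
      also have "\<dots> = lconv (lconv (causal k) (causal l)) (causal r) t"
        by (rule lconv_assoc) (use elim in auto)
      also have "\<dots> = lconv (causal (\<lambda>_. 1)) (causal r) t"
      proof -
        have "AE s in lborel. lconv (causal k) (causal l) (t + (-1) * s) = causal (\<lambda>_. 1) (t + (-1) * s)"
          by (rule AE_borel_affine) (use AE_kl in auto)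
        then show ?thesis
          unfolding lconv_def[of _ _ t]
          by (intro integral_cong_AE) (auto elim!: eventually_mono)
      qed
      finally show ?thesis .
    qed
    \<comment> \<open>Substituting \<open>l = r + \<eta> (r * l)\<close> into \<open>k * l\<close>
      and using \<open>k * (r * l) = 1 * r\<close> from above leaves
      \<open>k * r + \<eta> (1 * r)\<close>, which is \<open>(k + \<eta>) * r\<close>.\<close>
    have "lconv (causal k) (causal l) t =
        (\<integral>s. causal k (t - s) * (causal r s + \<eta> * lconv (causal r) (causal l) s) \<partial>lborel)"
      unfolding lconv_def[of "causal k" "causal l"]
      by (intro integral_cong_AE) (use AE_resolvent in \<open>auto elim!: eventually_mono\<close>)
    also have "\<dots> = lconv (causal k) (causal r) t + \<eta> * lconv (causal k) (lconv (causal r) (causal l)) t"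
      using i_kr i_krl unfolding lconv_def[of _ _ t] by (simp add: distrib_left mult.left_commute)
    also have "\<dots> = lconv (causal k) (causal r) t + \<eta> * lconv (causal (\<lambda>_. 1)) (causal r) t"
      by (simp only: 1)
    also have "\<dots> = lconv (causal ?k') (causal r) t"
      using i_kr i_1r unfolding lconv_def split by (simp add: distrib_right mult.assoc)
    finally have "lconv (causal ?k') (causal r) t = causal (\<lambda>_. 1) t"
      using elim(5) by (rule trans[OF sym])
    then show ?case by (metis causal_pos)
  qed
  then show ?thesis
    by (intro AE_nonneg) (use L1_loc_causal(2)[OF L1(3)] in auto)
qed

abbreviation "nl \<equiv> \<lambda>t. ennreal (causal l t)"
abbreviation "nr \<equiv> \<lambda>t. ennreal (causal r t)"
abbreviation "n1 \<equiv> \<lambda>t. ennreal (causal (\<lambda>_. 1) t)"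

lemma causal_L1_ennreal:
  assumes "L1_loc f"
  shows "causal_L1 (\<lambda>t. ennreal (causal f t))"
proof -
  have "(\<integral>\<^sup>+t. indicator {..T} t * ennreal (causal f t) \<partial>lborel) < \<infinity>" for T
  proof -
    have "(\<integral>\<^sup>+t. indicator {..T} t * ennreal (causal f t) \<partial>lborel) \<le>
        (\<integral>\<^sup>+t. indicator {..T} t * ennreal \<bar>causal f t\<bar> \<partial>lborel)"
      by (intro nn_integral_mono mult_left_mono ennreal_leI) auto
    also have "\<dots> < \<infinity>"
      using causal_L1_abs[OF assms] unfolding causal_L1_def by (elim conjE) (erule spec)
    finally show ?thesis .
  qed
  then show ?thesis
    using L1_loc_causal(1)[OF assms] by (auto simp: causal_L1_def)
qed

definition W :: "real \<Rightarrow> real" where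
  "W = conv (\<lambda>_. 1) (conv l r)"

text \<open>Finiteness holds at every \<open>t\<close>, as pointwise asymptotics require:
  convolution with 1 is integration over \<open>{..t}\<close> of a locally integrable
  function.\<close>

lemma finite_W: "nn_conv n1 (nn_conv nl nr) t < \<infinity>"
proof -
  have "nn_conv n1 (nn_conv nl nr) t \<le> (\<integral>\<^sup>+s. indicator {..t} s * nn_conv nl nr s \<partial>lborel)"
    unfolding nn_conv_def[of n1 _ t]
  proof (intro nn_integral_mono mult_right_mono)
    show "n1 (t - s) \<le> indicator {..t} s" for s
      by (cases "s < t") auto
  qed simp
  also have "\<dots> < \<infinity>"
  proof -
    have "causal_L1 (nn_conv nl nr)"
      by (intro causal_L1_nn_conv causal_L1_ennreal L1)
    then show ?thesis unfolding causal_L1_def by (elim conjE) (erule spec)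
  qed
  finally show ?thesis .
qed

text \<open>The inner real convolution matches its extended counterpart only where the latter is
  finite, hence almost everywhere; the outer integration does not see the exceptional set.\<close>

lemma W_eq: "W t = enn2real (nn_conv n1 (nn_conv nl nr) t)"
proof -
  have c: "causal (conv l r) = lconv (causal l) (causal r)"
  proof
    fix t
    show "causal (conv l r) t = lconv (causal l) (causal r) t"
      by (cases "t > 0") (simp_all add: conv_eq_lconv lconv_nonpos)
  qed
  have lr: "lconv (causal l) (causal r) s = enn2real (nn_conv nl nr s)" for s
    by (intro lconv_eq_enn2real AE_l_nonneg AE_r_nonneg) auto
  have "AE s in lborel. nn_conv nl nr s < \<infinity>"
    by (intro causal_L1_AE_finite causal_L1_nn_conv causal_L1_ennreal L1)
  then have ae: "AE s in lborel. ennreal (lconv (causal l) (causal r) s) = nn_conv nl nr s"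
    by eventually_elim (simp add: lr)
  have "W t = enn2real (nn_conv n1 (\<lambda>s. ennreal (lconv (causal l) (causal r) s)) t)"
    unfolding W_def conv_eq_lconv[of "\<lambda>_. 1"] c
  proof (rule lconv_eq_enn2real)
    show "AE t in lborel. 0 \<le> causal (\<lambda>_. 1) t" by (simp add: causal_def)
    show "AE t in lborel. 0 \<le> lconv (causal l) (causal r) t" by (simp add: lr)
  qed measurable
  also have "nn_conv n1 (\<lambda>s. ennreal (lconv (causal l) (causal r) s)) t = nn_conv n1 (nn_conv nl nr) t"
    unfolding nn_conv_def[of n1]
    by (intro nn_integral_cong_AE) (use ae in \<open>auto elim!: eventually_mono\<close>)
  finally show ?thesis .
qed

lemma ennreal_W: "ennreal (W t) = nn_conv n1 (nn_conv nl nr) t"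
  using finite_W[of t] by (simp add: W_eq)

lemma W_nonpos: "t \<le> 0 \<Longrightarrow> W t = 0"
  unfolding W_def conv_eq_lconv by (intro lconv_nonpos) auto

lemma W_nonneg: "0 \<le> W t"
  by (simp add: W_eq)

lemma mono_W: "mono W"
proof
  fix s t :: real assume "s \<le> t"
  then have "nn_conv n1 (nn_conv nl nr) s \<le> nn_conv n1 (nn_conv nl nr) t"
    unfolding nn_conv_def[of n1]
    by (intro nn_integral_mono mult_right_mono) (auto simp: causal_def indicator_def)
  then have "ennreal (W s) \<le> ennreal (W t)" by (simp add: ennreal_W)
  then show "W s \<le> W t" using W_nonneg[of t] by (simp add: ennreal_le_iff)
qed

lemma laplace_eq: "laplace l x = (\<integral>t. exp (- x * t) * causal l t \<partial>lborel)"
  unfolding laplace_def set_lebesgue_integral_def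
  by (rule integral_discrete_difference[of "{0}"]) (auto simp: indicator_def causal_def)

lemma nn_laplace_l_eq: "nn_laplace nl x = (\<integral>\<^sup>+t. ennreal (exp (- x * t) * causal l t) \<partial>lborel)"
  unfolding nn_laplace_def by (intro nn_integral_cong) (simp add: ennreal_mult')

text \<open>A nonzero Bochner integral cannot be the default value 0. In this way the positivity
  contained in regular variation guarantees that the Laplace integral converges.\<close>

lemma integrable_laplace_l:
  assumes "0 < laplace l x"
  shows "integrable lborel (\<lambda>t. exp (- x * t) * causal l t)"
  using assms not_integrable_integral_eq unfolding laplace_eq by fastforce

lemma nn_laplace_l:
  assumes "0 < laplace l x"
  shows "nn_laplace nl x = ennreal (laplace l x)"
  unfolding nn_laplace_l_eq laplace_eq
proof (rule nn_integral_eq_integral[OF integrable_laplace_l[OF assms]])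
  show "AE t in lborel. 0 \<le> exp (- x * t) * causal l t"
    using AE_l_nonneg by eventually_elim simp
qed

text \<open>The transformed resolvent equation is first read in \<open>ennreal\<close>, where the
  transform of \<open>r\<close> might be infinite. As a summand of the finite transform of
  \<open>l\<close> it is finite, and only then can the equation be solved for it over the
  reals.\<close>

lemma nn_laplace_r:
  assumes pos: "0 < laplace l x"
  shows "nn_laplace nr x = ennreal (laplace l x / (1 + \<eta> * laplace l x))"
proof -
  have rl: "lconv (causal r) (causal l) t = enn2real (nn_conv nr nl t)" for t
    by (intro lconv_eq_enn2real AE_l_nonneg AE_r_nonneg) auto
  have "AE t in lborel. nn_conv nr nl t < \<infinity>"
    by (intro causal_L1_AE_finite causal_L1_nn_conv causal_L1_ennreal L1)
  then have "AE t in lborel. nl t = nr t + ennreal \<eta> * nn_conv nr nl t"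
    using AE_resolvent AE_r_nonneg
  proof eventually_elim
    case (elim t)
    have "nl t = ennreal (causal r t + \<eta> * enn2real (nn_conv nr nl t))"
      using elim by (simp add: rl)
    also have "\<dots> = nr t + ennreal \<eta> * nn_conv nr nl t"
      using elim \<eta> by (simp add: ennreal_plus ennreal_mult)
    finally show ?case .
  qed
  then have "nn_laplace nl x = (\<integral>\<^sup>+t. ennreal (exp (- x * t)) * nr t + ennreal \<eta> * (ennreal (exp (- x * t)) * nn_conv nr nl t) \<partial>lborel)"
    unfolding nn_laplace_def
    by (intro nn_integral_cong_AE) (auto elim!: eventually_mono simp: distrib_left mult.left_commute)
  also have "\<dots> = nn_laplace nr x + ennreal \<eta> * (nn_laplace nr x * nn_laplace nl x)"
  proof -
    have "nn_laplace (nn_conv nr nl) x = nn_laplace nr x * nn_laplace nl x"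
      by (rule nn_laplace_nn_conv) measurable
    then show ?thesis
      unfolding nn_laplace_def by (subst nn_integral_add) (auto simp: nn_integral_cmult)
  qed
  finally have eq: "ennreal (laplace l x) = nn_laplace nr x + ennreal \<eta> * (nn_laplace nr x * ennreal (laplace l x))"
    by (simp only: nn_laplace_l[OF pos])
  have "nn_laplace nr x \<le> nn_laplace nr x + ennreal \<eta> * (nn_laplace nr x * ennreal (laplace l x))"
    by (simp add: add_increasing2)
  also have "\<dots> = ennreal (laplace l x)"
    by (rule eq[symmetric])
  finally have "nn_laplace nr x < \<infinity>"
    using le_less_trans by fastforce
  then obtain \<rho> where \<rho>: "nn_laplace nr x = ennreal \<rho>" "\<rho> \<ge> 0"
    by (metis enn2real_nonneg ennreal_enn2real infinity_ennreal_def)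
  have "ennreal (laplace l x) = ennreal (\<rho> + \<eta> * (\<rho> * laplace l x))"
    using eq \<rho>(2) \<eta> pos by (simp add: \<rho>(1) ennreal_plus ennreal_mult)
  then have "laplace l x = \<rho> + \<eta> * (\<rho> * laplace l x)"
    using \<rho>(2) \<eta> pos by (subst (asm) ennreal_inj) auto
  then have "laplace l x = \<rho> * (1 + \<eta> * laplace l x)"
    by (simp add: algebra_simps)
  moreover have "1 + \<eta> * laplace l x > 0" using \<eta> pos by (simp add: add_pos_pos)
  moreover have "u = a / d" if "a = u * d" "d > 0" for u a d :: real
    using that by simp
  ultimately have "\<rho> = laplace l x / (1 + \<eta> * laplace l x)" by blast
  then show ?thesis using \<rho>(1) by (simp only:)
qed

lemma has_bochner_integral_W:
  assumes pos: "0 < laplace l x" and x: "x > 0"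
  shows "has_bochner_integral lborel (\<lambda>t. exp (- x * t) * W t)
    ((laplace l x)\<^sup>2 / (x * (1 + \<eta> * laplace l x)))"
proof (rule has_bochner_integral_nn_integral)
  have [measurable]: "W \<in> borel_measurable borel" by (rule borel_measurable_mono[OF mono_W])
  show "(\<lambda>t. exp (- x * t) * W t) \<in> borel_measurable lborel" by measurable
  have d: "1 + \<eta> * laplace l x > 0" using \<eta> pos by (simp add: add_pos_pos)
  then show "0 \<le> (laplace l x)\<^sup>2 / (x * (1 + \<eta> * laplace l x))" using x by simp
  have "(\<integral>\<^sup>+t. ennreal (exp (- x * t) * W t) \<partial>lborel) = nn_laplace (nn_conv n1 (nn_conv nl nr)) x"
    unfolding nn_laplace_def by (intro nn_integral_cong) (simp add: ennreal_mult' ennreal_W)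
  also have "\<dots> = nn_laplace n1 x * (nn_laplace nl x * nn_laplace nr x)"
  proof -
    have "nn_laplace (nn_conv nl nr) x = nn_laplace nl x * nn_laplace nr x"
      by (rule nn_laplace_nn_conv) measurable
    moreover have "nn_laplace (nn_conv n1 (nn_conv nl nr)) x = nn_laplace n1 x * nn_laplace (nn_conv nl nr) x"
      by (rule nn_laplace_nn_conv) measurable
    ultimately show ?thesis by simp
  qed
  also have "\<dots> = ennreal (1 / x * (laplace l x * (laplace l x / (1 + \<eta> * laplace l x))))"
  proof -
    have "0 \<le> 1 / x" "0 \<le> laplace l x" using x pos by simp_all
    then show ?thesis
      by (simp only: nn_laplace_one[OF x] nn_laplace_l[OF pos] nn_laplace_r[OF pos] ennreal_mult')
  qed
  also have "1 / x * (laplace l x * (laplace l x / (1 + \<eta> * laplace l x))) = (laplace l x)\<^sup>2 / (x * (1 + \<eta> * laplace l x))"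
    by (simp add: power2_eq_square)
  finally show "(\<integral>\<^sup>+t. ennreal (exp (- x * t) * W t) \<partial>lborel) = ennreal ((laplace l x)\<^sup>2 / (x * (1 + \<eta> * laplace l x)))" .
qed (auto simp: W_nonneg)

end

section \<open>Asymptotics at both ends of the half-line\<close>

context telegraph_kernel
begin

context
  assumes pos: "\<And>x. x > 0 \<Longrightarrow> 0 < laplace l x"
begin

text \<open>Karamata's theorem with \<open>x * transform x = (laplace l x)\<^sup>2 / (1 + \<eta> *
  laplace l x)\<close>. Both regimes are instances: \<open>at_top\<close> with \<alpha> = 1 - 2
  \<rho> for small times, \<open>at_right 0\<close> with \<alpha> = 1 + \<rho> for large
  times.\<close>

lemma W_asymp:
  assumes F: "\<forall>\<^sub>F x in F. x > 0" and \<alpha>: "\<alpha> > 0"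
    and ratio: "\<And>p. p > 0 \<Longrightarrow> ((\<lambda>x. ((laplace l (p * x))\<^sup>2 / (p * x * (1 + \<eta> * laplace l (p * x)))) /
      ((laplace l x)\<^sup>2 / (x * (1 + \<eta> * laplace l x)))) \<longlongrightarrow> p powr (- \<alpha>)) F"
  shows "((\<lambda>x. W (1 / x) * (1 + \<eta> * laplace l x) / (laplace l x)\<^sup>2) \<longlongrightarrow> 1 / Gamma \<alpha>) F"
proof -
  have transform: "(\<integral>t. exp (- x * t) * W t \<partial>lborel) = (laplace l x)\<^sup>2 / (x * (1 + \<eta> * laplace l x))" if "x > 0" for x
    using has_bochner_integral_W[OF pos[OF that] that] by (simp add: has_bochner_integral_iff)
  have den: "1 + \<eta> * laplace l x > 0" if "x > 0" for x
    using \<eta> pos[OF that] by (simp add: add_pos_pos)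
  interpret karamata W F \<alpha>
  proof
    show "mono W" by (rule mono_W)
    show "W t = 0" if "t \<le> 0" for t using that by (rule W_nonpos)
    show "integrable lborel (\<lambda>t. exp (- x * t) * W t)" if "x > 0" for x
      using has_bochner_integral_W[OF pos[OF that] that] by (simp add: has_bochner_integral_iff)
    show "0 < (\<integral>t. exp (- x * t) * W t \<partial>lborel)" if "x > 0" for x
      unfolding transform[OF that] using that pos[OF that] den[OF that] by simp
    show "((\<lambda>x. (\<integral>t. exp (- (real (Suc n) * x) * t) * W t \<partial>lborel) / (\<integral>t. exp (- x * t) * W t \<partial>lborel))
        \<longlongrightarrow> real (Suc n) powr (- \<alpha>)) F" for n
    proof (rule Lim_transform_eventually[OF ratio])
      show "\<forall>\<^sub>F x in F. ((laplace l (real (Suc n) * x))\<^sup>2 / (real (Suc n) * x * (1 + \<eta> * laplace l (real (Suc n) * x)))) /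
          ((laplace l x)\<^sup>2 / (x * (1 + \<eta> * laplace l x))) =
          (\<integral>t. exp (- (real (Suc n) * x) * t) * W t \<partial>lborel) / (\<integral>t. exp (- x * t) * W t \<partial>lborel)"
        using F
      proof eventually_elim
        case (elim x)
        then have "real (Suc n) * x > 0" by simp
        from transform[OF this] transform[OF elim] show ?case by (simp only:)
      qed
    qed simp
  qed (use F \<alpha> in auto)
  have rearrange: "w / (x * (a / (x * d))) = w * d / a" if "x \<noteq> 0" for w x a d :: real
    using that by simp
  show ?thesis
  proof (rule Lim_transform_eventually[OF karamata])
    show "\<forall>\<^sub>F x in F. W (1 / x) / (x * transform x) = W (1 / x) * (1 + \<eta> * laplace l x) / (laplace l x)\<^sup>2"
      using F
    proof eventually_elim
      case (elim x)
      show ?case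
        unfolding transform_def transform[OF elim] by (rule rearrange) (use elim in simp)
    qed
  qed
qed

lemma laplace_tendsto_0: "(laplace l \<longlongrightarrow> 0) at_top"
proof -
  have "((\<lambda>x. \<integral>t. exp (- x * t) * causal l t \<partial>lborel) \<longlongrightarrow> integral\<^sup>L lborel (\<lambda>t::real. 0)) at_top"
  proof (rule integral_dominated_convergence_at_top)
    show "integrable lborel (\<lambda>t. \<bar>exp (- 1 * t) * causal l t\<bar>)"
      by (intro integrable_abs integrable_laplace_l pos) simp
    show "\<forall>\<^sub>F x in at_top. AE t in lborel. norm (exp (- x * t) * causal l t) \<le> \<bar>exp (- 1 * t) * causal l t\<bar>"
      using eventually_ge_at_top[of 1]
    proof eventually_elim
      case (elim x)
      have "norm (exp (- x * t) * causal l t) \<le> \<bar>exp (- 1 * t) * causal l t\<bar>" for t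
        using elim by (cases "t > 0") (auto simp: abs_mult intro!: mult_right_mono)
      then show ?case by simp
    qed
    show "AE t in lborel. ((\<lambda>x. exp (- x * t) * causal l t) \<longlongrightarrow> 0) at_top"
    proof (intro always_eventually allI)
      fix t :: real
      show "((\<lambda>x. exp (- x * t) * causal l t) \<longlongrightarrow> 0) at_top"
      proof (cases "t > 0")
        case True
        have "filterlim (\<lambda>x. x * t) at_top at_top"
          using True by (intro filterlim_at_top_mult_tendsto_pos[OF tendsto_const] filterlim_ident)
        then have "((\<lambda>x. exp (- (x * t))) \<longlongrightarrow> 0) at_top"
          by (intro filterlim_compose[OF exp_at_bot] filterlim_compose[OF filterlim_uminus_at_bot_at_top])
        then have "((\<lambda>x. exp (- (x * t)) * causal l t) \<longlongrightarrow> 0 * causal l t) at_top"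
          by (intro tendsto_intros)
        then show ?thesis by simp
      qed simp
    qed
  qed measurable
  then show ?thesis by (simp add: laplace_eq[abs_def])
qed

lemma laplace_antimono:
  assumes "0 < x" "x \<le> y"
  shows "laplace l y \<le> laplace l x"
  unfolding laplace_eq
proof (rule integral_mono_AE)
  show "AE t in lborel. exp (- y * t) * causal l t \<le> exp (- x * t) * causal l t"
    using AE_l_nonneg
  proof eventually_elim
    case (elim t)
    then show ?case using assms by (cases "t > 0") (auto intro!: mult_right_mono)
  qed
  show "integrable lborel (\<lambda>t. exp (- y * t) * causal l t)" "integrable lborel (\<lambda>t. exp (- x * t) * causal l t)"
    using assms by (intro integrable_laplace_l pos; simp)+
qed

text \<open>Since \<open>l\<close> is nonnegative almost everywhere, failure of integrability means
  an infinite integral. Monotone convergence along \<open>x = 1 / Suc n\<close> yields an unbounded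
  sequence, and \<open>laplace_antimono\<close> extends this to all small \<open>x\<close>.\<close>

lemma laplace_at_top:
  assumes not_int: "\<not> set_integrable lborel {0..} l"
  shows "filterlim (laplace l) at_top (at_right 0)"
proof -
  define f where "f n t = ennreal (exp (- (1 / real (Suc n)) * t)) * nl t" for n t
  have SUP: "(SUP n. f n t) = nl t" for t
  proof (rule LIMSEQ_unique)
    have "incseq (\<lambda>n. f n t)"
    proof (cases "t > 0")
      case True
      show ?thesis
        unfolding f_def using True
        by (intro incseq_SucI mult_right_mono ennreal_leI) (auto simp: field_simps)
    qed (simp add: f_def)
    then show "(\<lambda>n. f n t) \<longlonglongrightarrow> (SUP n. f n t)" by (rule LIMSEQ_SUP)
    have "(\<lambda>n. exp (- (1 / real (Suc n)) * t)) \<longlonglongrightarrow> exp (- 0 * t)"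
      by (intro tendsto_intros LIMSEQ_Suc[OF lim_const_over_n])
    then have "(\<lambda>n. ennreal (exp (- (1 / real (Suc n)) * t))) \<longlonglongrightarrow> ennreal (exp (- 0 * t))"
      by (rule tendsto_ennrealI)
    then have "(\<lambda>n. f n t) \<longlonglongrightarrow> ennreal (exp (- 0 * t)) * nl t"
      unfolding f_def by (intro tendsto_mult_ennreal tendsto_const) auto
    then show "(\<lambda>n. f n t) \<longlonglongrightarrow> nl t" by simp
  qed
  have "(\<integral>\<^sup>+t. nl t \<partial>lborel) = \<infinity>"
  proof (rule ccontr)
    assume "\<not> ?thesis"
    then have fin: "(\<integral>\<^sup>+t. nl t \<partial>lborel) < \<infinity>" by (simp add: less_top)
    have "(\<integral>\<^sup>+t. ennreal (norm (causal l t)) \<partial>lborel) = (\<integral>\<^sup>+t. nl t \<partial>lborel)"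
      by (intro nn_integral_cong_AE) (use AE_l_nonneg in \<open>auto elim!: eventually_mono\<close>)
    then have "integrable lborel (causal l)"
      using fin by (intro integrableI_bounded) auto
    then have "integrable lborel (\<lambda>t. indicator {0..} t *\<^sub>R l t)"
      by (rule integrable_discrete_difference[where X="{0}", THEN iffD1, rotated -1]) (auto simp: causal_def indicator_def)
    then show False using not_int by (simp add: set_integrable_def)
  qed
  moreover have "(\<integral>\<^sup>+t. (SUP n. f n t) \<partial>lborel) = (SUP n. \<integral>\<^sup>+t. f n t \<partial>lborel)"
  proof (rule nn_integral_monotone_convergence_SUP)
    show "incseq f"
    proof (intro incseq_SucI le_funI)
      fix n t
      show "f n t \<le> f (Suc n) t"
      proof (cases "t > 0")
        case True
        then show ?thesis
          unfolding f_def by (intro mult_right_mono ennreal_leI) (auto simp: field_simps)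
      qed (simp add: f_def)
    qed
  qed (simp add: f_def)
  moreover have "(\<integral>\<^sup>+t. f n t \<partial>lborel) = ennreal (laplace l (1 / real (Suc n)))" for n
    using nn_laplace_l[OF pos[of "1 / real (Suc n)"]] by (simp add: f_def nn_laplace_def)
  ultimately have top: "(SUP n. ennreal (laplace l (1 / real (Suc n)))) = \<infinity>"
    by (simp add: SUP)
  show ?thesis
    unfolding filterlim_at_top
  proof
    fix Z :: real
    have "ennreal \<bar>Z\<bar> < (SUP n. ennreal (laplace l (1 / real (Suc n))))"
      unfolding top by simp
    then obtain n where "ennreal \<bar>Z\<bar> < ennreal (laplace l (1 / real (Suc n)))"
      unfolding less_SUP_iff by blast
    then have n: "Z \<le> laplace l (1 / real (Suc n))"
      using ennreal_less_iff[of "\<bar>Z\<bar>"] by simp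
    have "\<forall>\<^sub>F x in at_right 0. x \<in> {0<..<1 / real (Suc n)}"
      by (rule eventually_at_right_real) simp
    then show "\<forall>\<^sub>F x in at_right 0. Z \<le> laplace l x"
    proof eventually_elim
      case (elim x)
      then show ?case using n laplace_antimono[of x "1 / real (Suc n)"] by simp
    qed
  qed
qed

lemma W_asymp_at_right:
  assumes rv: "\<And>p. p > 0 \<Longrightarrow> ((\<lambda>x. laplace l (x * p) / laplace l x) \<longlongrightarrow> p powr \<rho>) at_top"
    and \<rho>: "\<rho> < 1 / 2"
  shows "((\<lambda>t. W t / (laplace l (1 / t))\<^sup>2) \<longlongrightarrow> 1 / Gamma (1 - 2 * \<rho>)) (at_right 0)"
proof -
  have ev: "\<forall>\<^sub>F x :: real in at_top. x > 0" by (rule eventually_gt_at_top)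
  have den: "1 + \<eta> * laplace l x > 0" if "x > 0" for x
    using \<eta> pos[OF that] by (simp add: add_pos_pos)
  have cancel: "w * d / a / d = w / a" if "d > 0" for w d a :: real
    using that by simp
  have "((\<lambda>x. W (1 / x) * (1 + \<eta> * laplace l x) / (laplace l x)\<^sup>2) \<longlongrightarrow> 1 / Gamma (1 - 2 * \<rho>)) at_top"
  proof (rule W_asymp[OF ev])
    fix p :: real assume p: "p > 0"
    have *: "((\<lambda>x. laplace l (p * x)) \<longlongrightarrow> 0) at_top"
      using p by (intro filterlim_compose[OF laplace_tendsto_0]
          filterlim_tendsto_pos_mult_at_top[OF tendsto_const] filterlim_ident)
    \<comment> \<open>The squared ratio contributes the exponent 2 \<rho> and the factor
      \<open>1 / p\<close> contributes -1. The middle quotient tends to 1 because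
      \<open>laplace l\<close> vanishes at infinity.\<close>
    have "((\<lambda>x. (laplace l (x * p) / laplace l x)\<^sup>2 * ((1 + \<eta> * laplace l x) / (1 + \<eta> * laplace l (p * x))) / p)
       \<longlongrightarrow> (p powr \<rho>)\<^sup>2 * ((1 + \<eta> * 0) / (1 + \<eta> * 0)) / p) at_top"
      using p by (intro tendsto_intros rv laplace_tendsto_0 *) auto
    also have "(p powr \<rho>)\<^sup>2 * ((1 + \<eta> * 0) / (1 + \<eta> * 0)) / p = p powr (- (1 - 2 * \<rho>))"
    proof -
      have "(p powr \<rho>)\<^sup>2 = p powr (2 * \<rho>)" by (simp add: power2_eq_square flip: powr_add)
      then show ?thesis using p by (simp add: powr_diff)
    qed
    finally show "((\<lambda>x. ((laplace l (p * x))\<^sup>2 / (p * x * (1 + \<eta> * laplace l (p * x)))) /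
        ((laplace l x)\<^sup>2 / (x * (1 + \<eta> * laplace l x)))) \<longlongrightarrow> p powr (- (1 - 2 * \<rho>))) at_top"
    proof (rule Lim_transform_eventually)
      show "\<forall>\<^sub>F x in at_top. (laplace l (x * p) / laplace l x)\<^sup>2 * ((1 + \<eta> * laplace l x) / (1 + \<eta> * laplace l (p * x))) / p =
        ((laplace l (p * x))\<^sup>2 / (p * x * (1 + \<eta> * laplace l (p * x)))) / ((laplace l x)\<^sup>2 / (x * (1 + \<eta> * laplace l x)))"
        using ev by eventually_elim (use p in \<open>simp add: power_divide mult.commute\<close>)
    qed
  qed (use \<rho> in simp)
  moreover have "((\<lambda>x. 1 + \<eta> * laplace l x) \<longlongrightarrow> 1 + \<eta> * 0) at_top"
    by (intro tendsto_intros laplace_tendsto_0)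
  ultimately have "((\<lambda>x. W (1 / x) * (1 + \<eta> * laplace l x) / (laplace l x)\<^sup>2 / (1 + \<eta> * laplace l x))
      \<longlongrightarrow> 1 / Gamma (1 - 2 * \<rho>) / (1 + \<eta> * 0)) at_top"
    by (rule tendsto_divide) simp
  then have "((\<lambda>x. W (1 / x) / (laplace l x)\<^sup>2) \<longlongrightarrow> 1 / Gamma (1 - 2 * \<rho>) / (1 + \<eta> * 0)) at_top"
  proof (rule Lim_transform_eventually)
    show "\<forall>\<^sub>F x in at_top. W (1 / x) * (1 + \<eta> * laplace l x) / (laplace l x)\<^sup>2 / (1 + \<eta> * laplace l x) =
        W (1 / x) / (laplace l x)\<^sup>2"
      using ev
    proof eventually_elim
      case (elim x)
      show ?case by (rule cancel[OF den[OF elim]])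
    qed
  qed
  then have "((\<lambda>x. W (1 / x) / (laplace l x)\<^sup>2) \<longlongrightarrow> 1 / Gamma (1 - 2 * \<rho>)) at_top"
    by simp
  then have "((\<lambda>t. W (1 / inverse t) / (laplace l (inverse t))\<^sup>2) \<longlongrightarrow> 1 / Gamma (1 - 2 * \<rho>)) (at_right 0)"
    by (rule filterlim_compose[OF _ filterlim_inverse_at_top_right])
  then show ?thesis by (simp add: inverse_eq_divide)
qed

lemma W_asymp_at_top:
  assumes rv: "\<And>p. p > 0 \<Longrightarrow> ((\<lambda>t. laplace l (1 / (t * p)) / laplace l (1 / t)) \<longlongrightarrow> p powr \<rho>) at_top"
    and \<rho>: "\<rho> > - 1" and not_int: "\<not> set_integrable lborel {0..} l"
  shows "((\<lambda>t. W t / laplace l (1 / t)) \<longlongrightarrow> 1 / (\<eta> * Gamma (1 + \<rho>))) at_top"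
proof -
  have ev: "\<forall>\<^sub>F x :: real in at_right 0. x > 0" by (rule eventually_at_right_less)
  have den: "1 + \<eta> * laplace l x > 0" if "x > 0" for x
    using \<eta> pos[OF that] by (simp add: add_pos_pos)
  have inv0: "((\<lambda>x. inverse (laplace l x)) \<longlongrightarrow> 0) (at_right 0)"
    by (rule tendsto_inverse_0_at_top[OF laplace_at_top[OF not_int]])
  \<comment> \<open>With \<open>t = 1 / x\<close> and \<open>inverse p\<close> in place of
    \<open>p\<close>, index \<rho> at infinity becomes exponent -\<rho> at 0.\<close>
  have rv': "((\<lambda>x. laplace l (p * x) / laplace l x) \<longlongrightarrow> p powr (- \<rho>)) (at_right 0)" if p: "p > 0" for p
  proof -
    have "((\<lambda>x. laplace l (1 / (inverse x * inverse p)) / laplace l (1 / inverse x)) \<longlongrightarrow> inverse p powr \<rho>) (at_right 0)"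
      using p by (intro filterlim_compose[OF rv filterlim_inverse_at_top_right]) simp
    moreover have "1 / (inverse x * inverse p) = p * x" "1 / inverse x = x" for x
      by (simp_all add: divide_inverse mult.commute)
    moreover have "inverse p powr \<rho> = p powr (- \<rho>)"
      using p by (simp add: powr_minus inverse_powr)
    ultimately show ?thesis by (simp only:)
  qed
  have "((\<lambda>x. W (1 / x) * (1 + \<eta> * laplace l x) / (laplace l x)\<^sup>2) \<longlongrightarrow> 1 / Gamma (1 + \<rho>)) (at_right 0)"
  proof (rule W_asymp[OF ev])
    fix p :: real assume p: "p > 0"
    \<comment> \<open>Here \<open>laplace l x\<close> diverges, so the quotient of the terms
      \<open>1 + \<eta> * laplace l\<close> is divided through by \<open>laplace l x\<close> to
      obtain finite limits. It contributes the exponent \<rho>, which together with -2 \<rho> and -1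
      gives -(1 + \<rho>).\<close>
    have "((\<lambda>x. (laplace l (p * x) / laplace l x)\<^sup>2 *
        ((inverse (laplace l x) + \<eta>) / (inverse (laplace l x) + \<eta> * (laplace l (p * x) / laplace l x))) / p)
       \<longlongrightarrow> (p powr (- \<rho>))\<^sup>2 * ((0 + \<eta>) / (0 + \<eta> * p powr (- \<rho>))) / p) (at_right 0)"
      using p \<eta> by (intro tendsto_intros rv' inv0) auto
    also have "(p powr (- \<rho>))\<^sup>2 * ((0 + \<eta>) / (0 + \<eta> * p powr (- \<rho>))) / p = p powr (- (1 + \<rho>))"
      using p \<eta> by (simp add: power2_eq_square powr_diff powr_minus field_simps)
    finally show "((\<lambda>x. ((laplace l (p * x))\<^sup>2 / (p * x * (1 + \<eta> * laplace l (p * x)))) /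
        ((laplace l x)\<^sup>2 / (x * (1 + \<eta> * laplace l x)))) \<longlongrightarrow> p powr (- (1 + \<rho>))) (at_right 0)"
    proof (rule Lim_transform_eventually)
      show "\<forall>\<^sub>F x in at_right 0. (laplace l (p * x) / laplace l x)\<^sup>2 *
          ((inverse (laplace l x) + \<eta>) / (inverse (laplace l x) + \<eta> * (laplace l (p * x) / laplace l x))) / p =
        ((laplace l (p * x))\<^sup>2 / (p * x * (1 + \<eta> * laplace l (p * x)))) / ((laplace l x)\<^sup>2 / (x * (1 + \<eta> * laplace l x)))"
        using ev
      proof eventually_elim
        case (elim x)
        have L: "laplace l x > 0" using pos elim by blast
        have "(inverse (laplace l x) + \<eta>) / (inverse (laplace l x) + \<eta> * (laplace l (p * x) / laplace l x)) =
            (1 + \<eta> * laplace l x) / (1 + \<eta> * laplace l (p * x))"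
        proof -
          have "inverse (laplace l x) + \<eta> = (1 + \<eta> * laplace l x) / laplace l x"
            "inverse (laplace l x) + \<eta> * (laplace l (p * x) / laplace l x) = (1 + \<eta> * laplace l (p * x)) / laplace l x"
            using L by (auto simp: field_simps)
          then show ?thesis using L by simp
        qed
        then show ?case using elim p by (simp add: power_divide mult.commute)
      qed
    qed
  qed (use \<rho> in simp)
  \<comment> \<open>This sum equals \<open>(1 + \<eta> * laplace l x) / laplace l x\<close>.
    Dividing by it cancels one power of \<open>laplace l x\<close>, and its limit \<eta> enters the
    final constant.\<close>
  moreover have "((\<lambda>x. inverse (laplace l x) + \<eta>) \<longlongrightarrow> 0 + \<eta>) (at_right 0)"
    by (intro tendsto_intros inv0)
  ultimately have "((\<lambda>x. W (1 / x) * (1 + \<eta> * laplace l x) / (laplace l x)\<^sup>2 / (inverse (laplace l x) + \<eta>))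
      \<longlongrightarrow> 1 / Gamma (1 + \<rho>) / (0 + \<eta>)) (at_right 0)"
    by (rule tendsto_divide) (use \<eta> in simp)
  then have "((\<lambda>x. W (1 / x) / laplace l x) \<longlongrightarrow> 1 / Gamma (1 + \<rho>) / (0 + \<eta>)) (at_right 0)"
  proof (rule Lim_transform_eventually)
    show "\<forall>\<^sub>F x in at_right 0. W (1 / x) * (1 + \<eta> * laplace l x) / (laplace l x)\<^sup>2 / (inverse (laplace l x) + \<eta>) = W (1 / x) / laplace l x"
      using ev
    proof eventually_elim
      case (elim x)
      have L: "laplace l x > 0" using pos elim by blast
      have "inverse (laplace l x) + \<eta> = (1 + \<eta> * laplace l x) / laplace l x"
        using L by (auto simp: field_simps)
      then show ?case using L den[OF elim] by (simp add: power2_eq_square)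
    qed
  qed
  then have "((\<lambda>t. W (1 / inverse t) / laplace l (inverse t)) \<longlongrightarrow> 1 / Gamma (1 + \<rho>) / (0 + \<eta>)) at_top"
    by (rule filterlim_compose[OF _ filterlim_inverse_at_right_top])
  then show ?thesis by (simp add: inverse_eq_divide mult.commute)
qed

end

end

text \<open>The limits for \<open>W\<close> are rescaled by \<open>2 * \<nu>\<close> and the Gamma
  factor into quotients tending to 1. In each case regular variation provides
  \<open>0 < laplace l x\<close> for all \<open>x > 0\<close>, the standing assumption behind those
  limits.\<close>

theorem theorem3p2:
  fixes k l r :: "real \<Rightarrow> real" and \<eta> \<nu> \<rho>1 \<rho>2 :: real
    and M :: "'a measure" and X :: "real \<Rightarrow> 'a \<Rightarrow> real"
  assumes "\<eta> > 0" and "\<nu> > 0"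
    and "kernel_PC k l"
    and "is_resolvent \<eta> l r"
    and "telegraph_process M k \<eta> \<nu> X"
    and "\<And>t. t \<ge> 0 \<Longrightarrow> prob_space.variance M (X t) = 2 * \<nu> * conv (\<lambda>_. 1) (conv l r) t"
  shows "(regularly_varying (laplace l) \<rho>1 \<and> \<rho>1 < 1 / 2 \<longrightarrow>
            (\<lambda>t. prob_space.variance M (X t)) \<sim>[at_right 0]
              (\<lambda>t. 2 * \<nu> / Gamma (1 - 2 * \<rho>1) * (laplace l (1 / t))\<^sup>2)) \<and>
         (regularly_varying (\<lambda>t. laplace l (1 / t)) \<rho>2 \<and> \<rho>2 > -1 \<and> \<not> set_integrable lborel {0..} l \<longrightarrow>
            (\<lambda>t. prob_space.variance M (X t)) \<sim>[at_top]
              (\<lambda>t. 2 * \<nu> / (\<eta> * Gamma (1 + \<rho>2)) * laplace l (1 / t)))"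
proof (intro conjI impI; elim conjE)
  interpret telegraph_kernel k l r \<eta>
    using assms by unfold_locales
  have var: "prob_space.variance M (X t) = 2 * \<nu> * W t" if "t > 0" for t
    using assms(6)[of t] that by (simp add: W_def)
  have cancel: "1 / c * c = 1" if "c > 0" for c :: real
    using that by simp
  {
    assume rv: "regularly_varying (laplace l) \<rho>1" and \<rho>: "\<rho>1 < 1 / 2"
    let ?G = "Gamma (1 - 2 * \<rho>1)"
    have G: "?G > 0" using \<rho> by (intro Gamma_real_pos) simp
    have "((\<lambda>t. W t / (laplace l (1 / t))\<^sup>2) \<longlongrightarrow> 1 / ?G) (at_right 0)"
      using rv \<rho> by (intro W_asymp_at_right) (auto simp: regularly_varying_def)
    then have "((\<lambda>t. W t / (laplace l (1 / t))\<^sup>2 * ?G) \<longlongrightarrow> 1 / ?G * ?G) (at_right 0)"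
      by (rule tendsto_mult_right)
    moreover have "1 / ?G * ?G = 1" by (rule cancel[OF G])
    ultimately have lim: "((\<lambda>t. W t / (laplace l (1 / t))\<^sup>2 * ?G) \<longlongrightarrow> 1) (at_right 0)"
      by (simp only:)
    show "(\<lambda>t. prob_space.variance M (X t)) \<sim>[at_right 0] (\<lambda>t. 2 * \<nu> / ?G * (laplace l (1 / t))\<^sup>2)"
    proof (rule asymp_equivI', rule Lim_transform_eventually[OF lim])
      show "\<forall>\<^sub>F t in at_right 0. W t / (laplace l (1 / t))\<^sup>2 * ?G =
          prob_space.variance M (X t) / (2 * \<nu> / ?G * (laplace l (1 / t))\<^sup>2)"
        using eventually_at_right_less[of 0]
        by eventually_elim (use \<open>\<nu> > 0\<close> G in \<open>simp add: var\<close>)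
    qed
  }
  {
    assume rv: "regularly_varying (\<lambda>t. laplace l (1 / t)) \<rho>2" and \<rho>: "\<rho>2 > -1"
      and not_int: "\<not> set_integrable lborel {0..} l"
    let ?G = "\<eta> * Gamma (1 + \<rho>2)"
    have G: "?G > 0" using \<rho> \<eta> by (intro mult_pos_pos Gamma_real_pos) simp_all
    have pos: "0 < laplace l x" if "x > 0" for x
    proof -
      have "\<forall>t>0. 0 < laplace l (1 / t)" using rv by (simp add: regularly_varying_def)
      from this[rule_format, of "1 / x"] show ?thesis using that by simp
    qed
    have "((\<lambda>t. W t / laplace l (1 / t)) \<longlongrightarrow> 1 / ?G) at_top"
      using rv \<rho> not_int pos by (intro W_asymp_at_top) (auto simp: regularly_varying_def)
    then have "((\<lambda>t. W t / laplace l (1 / t) * ?G) \<longlongrightarrow> 1 / ?G * ?G) at_top"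
      by (rule tendsto_mult_right)
    moreover have "1 / ?G * ?G = 1" by (rule cancel[OF G])
    ultimately have lim: "((\<lambda>t. W t / laplace l (1 / t) * ?G) \<longlongrightarrow> 1) at_top"
      by (simp only:)
    show "(\<lambda>t. prob_space.variance M (X t)) \<sim>[at_top] (\<lambda>t. 2 * \<nu> / ?G * laplace l (1 / t))"
    proof (rule asymp_equivI', rule Lim_transform_eventually[OF lim])
      show "\<forall>\<^sub>F t in at_top. W t / laplace l (1 / t) * ?G =
          prob_space.variance M (X t) / (2 * \<nu> / ?G * laplace l (1 / t))"
        using eventually_gt_at_top[of 0]
        by eventually_elim (use \<open>\<nu> > 0\<close> G in \<open>simp add: var\<close>)
    qed
  }
qed

end
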